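(* Let $(X,d)$ be a locally compact metric space such that for every $\rho>0$ the space $X$ can be covered by a countable collection of balls with diameters $<\rho$. Let $g$ be a doubling dimension function and suppose there exist constants $0<c_1<1<c_2<\infty$ and $r_0>0$ such that $$c_1\,g(r(B))\le\mathcal{H}^g(B)\le c_2\,g(r(B))$$ for any ball $B=B(x,r)$ with $x\in X$ and $r\le r_0$. Let $\{B_i\}_{i\in\mathbb{N}}$ be a sequence of balls in $X$ with $r(B_i)\to0$ as $i\to\infty$. Let $f$ be a dimension function such that $f(x)/g(x)$ is monotonic and suppose that for any ball $B$ in $X$ $$\mathcal{H}^g\big(B\cap\limsup_{i\to\infty}B_i^f\big)=\mathcal{H}^g(B).$$ Then, for any ball $B$ in $X$ $$\mathcal{H}^f\big(B\cap\limsup_{i\to\infty}B_i^g\big)=\mathcal{H}^f(B).$$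
   Context: $\mathbb{R}^+=(0,\infty)$. Balls are sets $B=B(x,r)=\{y\in X: d(x,y)\le r\}$, given with a fixed centre $x\in X$ and radius $r=r(B)>0$ (which need not be uniquely determined by the set). A dimension function is a continuous, nondecreasing function $f:\mathbb{R}^+\to\mathbb{R}^+$ with $f(r)\to0$ as $r\to0$. A function $g$ is doubling if there is a constant $\lambda>1$ such that $g(2x)\le\lambda g(x)$ for all $x>0$. For a dimension function $f$ and a ball $B=B(x,r)$ in $X$, $B^f:=B(x,g^{-1}(f(r)))$, where $g^{-1}$ is the inverse of $g$ (the existence of $g^{-1}$ at the relevant values is implicit in this notation). In particular $B^g=B$. For a sequence of sets, $\limsup_{i\to\infty}B_i:=\bigcap_{j=1}^\infty\bigcup_{i\ge j}B_i$. For $F\subset X$ and $\rho>0$, let $\mathcal{H}^f_\rho(F)=\inf\sum_i f(r(B_i))$, the infimum being over all countable collections of balls $\{B_i\}$ with radii $r(B_i)\le\rho$ and $F\subset\bigcup_iB_i$. The Hausdorff $f$-measure is $\mathcal{H}^f(F)=\lim_{\rho\to0}\mathcal{H}^f_\rho(F)=\sup_{\rho>0}\mathcal{H}^f_\rho(F)$; $\mathcal{H}^g$ is defined likewise with $g$ in place of $f$. *)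

theory Defs
  imports "HOL-Analysis.Analysis"
begin

text \<open>Functions on the positive reals are total functions \<^typ>\<open>real \<Rightarrow> real\<close>
  whose values outside \<open>{0<..}\<close> are irrelevant.\<close>

definition dimension_function :: "(real \<Rightarrow> real) \<Rightarrow> bool" where
  "dimension_function f \<longleftrightarrow>
     (\<forall>r>0. f r > 0) \<and> continuous_on {0<..} f \<and> mono_on {0<..} f \<and> (f \<longlongrightarrow> 0) (at_right 0)"

definition doubling :: "(real \<Rightarrow> real) \<Rightarrow> bool" where
  "doubling g \<longleftrightarrow> (\<exists>L>1. \<forall>x>0. g (2 * x) \<le> L * g x)"

text \<open>The radius of a ball is not determined by the ball as a set, so balls are
  represented by pairs of a centre and a radius, the pair \<open>(x, r)\<close>
  standing for \<open>cball x r\<close>.\<close>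

definition ball_covers :: "real \<Rightarrow> 'a::metric_space set \<Rightarrow> ('a \<times> real) set set" where
  "ball_covers \<rho> F =
     {C. countable C \<and> (\<forall>(x, r)\<in>C. 0 < r \<and> r \<le> \<rho>) \<and> F \<subseteq> (\<Union>(x, r)\<in>C. cball x r)}"

definition hausdorff_premeasure ::
    "(real \<Rightarrow> real) \<Rightarrow> real \<Rightarrow> 'a::metric_space set \<Rightarrow> ennreal" where
  "hausdorff_premeasure f \<rho> F =
     (INF C\<in>ball_covers \<rho> F. infsum (\<lambda>(x, r). ennreal (f r)) C)"

definition hausdorff_measure ::
    "(real \<Rightarrow> real) \<Rightarrow> 'a::metric_space set \<Rightarrow> ennreal" where
  "hausdorff_measure f F = (SUP \<rho>\<in>{0<..}. hausdorff_premeasure f \<rho> F)"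

text \<open>For a ball \<open>B\<close> with centre \<open>x\<close> and radius \<open>r\<close>, this is the ball \<open>B\<^sup>f\<close> with centre
  \<open>x\<close> and radius \<open>g\<^sup>-\<^sup>1 (f r)\<close>.
  It is only meaningful if \<open>f r\<close> has exactly one preimage under \<open>g\<close> in \<open>{0<..}\<close>.\<close>

definition transformed_ball ::
    "(real \<Rightarrow> real) \<Rightarrow> (real \<Rightarrow> real) \<Rightarrow> 'a::metric_space \<Rightarrow> real \<Rightarrow> 'a set" where
  "transformed_ball g f x r = cball x (the_inv_into {0<..} g (f r))"

end

theory Submission
  imports Defs
begin

text \<open>
  Write \<open>\<mu>\<close> for the Hausdorff \<open>g\<close>-measure, \<open>s\<^sub>i\<close> for the radius with \<open>g s\<^sub>i = f r\<^sub>i\<close>, so that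
  \<open>B\<^sub>i\<^sup>f = cball x\<^sub>i s\<^sub>i\<close>, and \<open>\<Lambda>\<close> for the limsup of the original balls \<open>B\<^sub>i = cball x\<^sub>i r\<^sub>i\<close>.
  No measurability is used. The arguments need only that \<open>\<mu>\<close> is monotone, countably
  subadditive and superadditive on sets at positive distance from each other; disjoint closed
  balls acquire positive distance when they are replaced by concentric balls of half the radius,
  which costs a constant because \<open>g\<close> is doubling.

  The common tool is \<open>open_contains_disjoint_balls\<close>: every open set \<open>V\<close> contains finitely many
  disjoint balls \<open>B\<^sub>j\<^sup>f\<close> with arbitrarily large indices whose values \<open>g s\<^sub>j\<close> add up to a fixed
  proportion of \<open>\<mu> V\<close>. It follows by applying the Vitali covering lemma twice, once to the small
  balls in \<open>V\<close> and once, inside each ball selected, to the balls \<open>B\<^sub>j\<^sup>f\<close>, whose limsup has full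
  measure there by hypothesis.

  If \<open>f \<le> M * g\<close> near \<open>0\<close>, then \<open>g s\<^sub>i \<le> M * g r\<^sub>i\<close> for all large \<open>i\<close>, and the balls \<open>B\<^sub>j\<close> with the
  indices just chosen fill a fixed proportion of \<open>V\<close> as well. Removing them from \<open>V\<close> and repeating
  the step shows that the complement of \<open>\<Lambda>\<close> is \<open>\<mu>\<close>-null
  (\<open>null_outside_comparable_limsup\<close>), hence null for the Hausdorff \<open>f\<close>-measure, and the
  claim follows.

  Otherwise monotonicity makes \<open>f / g\<close> nonincreasing with limit \<open>\<infinity>\<close> at \<open>0\<close>, and the
  \<open>f\<close>-measure of the part of \<open>\<Lambda>\<close> in any ball is infinite (\<open>measure_limsup_infinite\<close>). For every
  \<open>\<eta> > 0\<close> one builds a Cantor set inside a compact ball: level \<open>n\<close> is a finite family of disjoint balls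
  \<open>B\<^sub>i\<close>, each carrying a mass at most \<open>f r\<^sub>i / \<eta>\<close>, the masses add up to \<open>1\<close>, and the mass in each
  ball is redistributed among the balls of the next level that it contains. A ball of radius \<open>\<rho>\<close>
  that meets more than one ball of a level meets balls of total mass at most a constant times
  \<open>f \<rho> / \<eta>\<close>. By compactness a cover of the Cantor set contains a finite cover of
  some level, so every cover by small balls has \<open>f\<close>-sum at least a constant times \<open>\<eta>\<close>.

  The redistribution has to gain the large factor \<open>f / g\<close>: one selection inside a ball of radius \<open>t\<close>
  yields \<open>\<Sum> g s\<^sub>j\<close> comparable only to \<open>g t\<close>. Since the balls \<open>B\<^sub>j\<close> are negligible for \<open>\<mu>\<close> compared
  with the balls \<open>B\<^sub>j\<^sup>f\<close>, almost all of the ball is still free after each selection, and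
  the selection is repeated with much smaller radii as often as needed (\<open>layered_exists\<close>).
\<close>

section \<open>Hausdorff measures as outer measures\<close>

lemma summable_on_ennreal_always [simp]:
  fixes f :: "'b \<Rightarrow> ennreal"
  shows "f summable_on A"
  by (rule nonneg_summable_on_complete) simp

lemma infsum_ennreal_leI:
  fixes f :: "'b \<Rightarrow> ennreal"
  assumes "\<And>F. finite F \<Longrightarrow> F \<subseteq> A \<Longrightarrow> sum f F \<le> b"
  shows "infsum f A \<le> b"
  by (subst nonneg_infsum_complete) (auto intro!: SUP_least assms)

lemma sum_le_infsum_ennreal:
  fixes f :: "'b \<Rightarrow> ennreal"
  assumes "finite F" "F \<subseteq> A"
  shows "sum f F \<le> infsum f A"
  by (subst nonneg_infsum_complete) (use assms in \<open>auto intro: SUP_upper\<close>)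

lemma infsum_UN_le_ennreal:
  fixes f :: "'b \<Rightarrow> ennreal"
  shows "infsum f (\<Union>j\<in>J. A j) \<le> infsum (\<lambda>j. infsum f (A j)) J"
proof (rule infsum_ennreal_leI)
  fix F assume F: "finite F" "F \<subseteq> (\<Union>j\<in>J. A j)"
  then have "\<forall>c\<in>F. \<exists>j. j \<in> J \<and> c \<in> A j" by blast
  then obtain n where n: "\<And>c. c \<in> F \<Longrightarrow> n c \<in> J \<and> c \<in> A (n c)" by metis
  have "sum f F = (\<Sum>j\<in>n ` F. \<Sum>c\<in>{c\<in>F. n c = j}. f c)"
    by (rule sum.group [symmetric]) (use F in auto)
  also have "\<dots> \<le> (\<Sum>j\<in>n ` F. infsum f (A j))"
  proof (intro sum_mono sum_le_infsum_ennreal)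
    fix j assume "j \<in> n ` F"
    show "finite {c \<in> F. n c = j}" using F by simp
    show "{c \<in> F. n c = j} \<subseteq> A j" using n by blast
  qed
  also have "\<dots> \<le> infsum (\<lambda>j. infsum f (A j)) J"
    by (rule sum_le_infsum_ennreal) (use F n in auto)
  finally show "sum f F \<le> \<dots>" .
qed

lemma hausdorff_premeasure_le:
  assumes "C \<in> ball_covers \<rho> F"
  shows "hausdorff_premeasure f \<rho> F \<le> infsum (\<lambda>(x, r). ennreal (f r)) C"
  unfolding hausdorff_premeasure_def using assms by (rule INF_lower)

lemma hausdorff_premeasure_mono:
  assumes "A \<subseteq> B"
  shows "hausdorff_premeasure f \<rho> A \<le> hausdorff_premeasure f \<rho> B"
  unfolding hausdorff_premeasure_def
  by (rule INF_superset_mono) (use assms in \<open>auto simp: ball_covers_def\<close>)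

lemma hausdorff_premeasure_antimono:
  assumes "\<rho> \<le> \<rho>'"
  shows "hausdorff_premeasure f \<rho>' A \<le> hausdorff_premeasure f \<rho> A"
  unfolding hausdorff_premeasure_def
  by (rule INF_superset_mono) (use assms in \<open>fastforce simp: ball_covers_def\<close>)+

lemma hausdorff_premeasure_le_measure:
  assumes "\<rho> > 0"
  shows "hausdorff_premeasure f \<rho> A \<le> hausdorff_measure f A"
  unfolding hausdorff_measure_def using assms by (intro SUP_upper) auto

lemma hausdorff_measure_mono:
  assumes "A \<subseteq> B"
  shows "hausdorff_measure f A \<le> hausdorff_measure f B"
  unfolding hausdorff_measure_def
  by (rule SUP_mono') (rule hausdorff_premeasure_mono [OF assms])

lemma hausdorff_premeasure_UN_le:
  fixes A :: "'b \<Rightarrow> 'a::metric_space set"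
  assumes J: "countable J"
  shows "hausdorff_premeasure f \<rho> (\<Union>j\<in>J. A j) \<le> infsum (\<lambda>j. hausdorff_premeasure f \<rho> (A j)) J"
    (is "_ \<le> infsum ?p J")
proof (cases "\<exists>j\<in>J. ?p j = top")
  case True
  then obtain j where "j \<in> J" "?p j = top" by blast
  then have "sum ?p {j} \<le> infsum ?p J"
    by (intro sum_le_infsum_ennreal) auto
  with \<open>?p j = top\<close> show ?thesis by (simp add: top_unique)
next
  case False
  show ?thesis
  proof (rule ennreal_le_epsilon)
    fix e :: real assume e: "e > 0"
    \<comment> \<open>the error \<open>e\<close> is shared out geometrically over the countable index set\<close>
    define d where "d j = e * (1/2) ^ Suc (to_nat_on J j)" for j
    have d: "d j > 0" for j using e by (simp add: d_def)
    have "\<exists>C. C \<in> ball_covers \<rho> (A j) \<and> infsum (\<lambda>(x, r). ennreal (f r)) C \<le> ?p j + ennreal (d j)"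
      if "j \<in> J" for j
    proof -
      have "?p j < ?p j + ennreal (d j)"
        using False that d [of j]
        using ennreal_add_left_cancel_less [of "?p j" 0 "ennreal (d j)"] by simp
      then show ?thesis
        unfolding hausdorff_premeasure_def INF_less_iff by (auto intro: less_imp_le)
    qed
    then obtain C where C: "\<And>j. j \<in> J \<Longrightarrow> C j \<in> ball_covers \<rho> (A j)"
      "\<And>j. j \<in> J \<Longrightarrow> infsum (\<lambda>(x, r). ennreal (f r)) (C j) \<le> ?p j + ennreal (d j)"
      by metis
    have "(\<Union>j\<in>J. C j) \<in> ball_covers \<rho> (\<Union>j\<in>J. A j)"
      using J C(1) unfolding ball_covers_def by fastforce
    then have "hausdorff_premeasure f \<rho> (\<Union>j\<in>J. A j)
        \<le> infsum (\<lambda>(x, r). ennreal (f r)) (\<Union>j\<in>J. C j)"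
      by (rule hausdorff_premeasure_le)
    also have "\<dots> \<le> infsum (\<lambda>j. infsum (\<lambda>(x, r). ennreal (f r)) (C j)) J"
      by (rule infsum_UN_le_ennreal)
    also have "\<dots> \<le> infsum (\<lambda>j. ?p j + ennreal (d j)) J"
      by (intro infsum_mono C(2)) auto
    also have "\<dots> = infsum ?p J + infsum (\<lambda>j. ennreal (d j)) J"
      by (intro infsum_add) auto
    also have "infsum (\<lambda>j. ennreal (d j)) J \<le> ennreal e"
    proof (rule infsum_ennreal_leI)
      fix F assume F: "finite F" "F \<subseteq> J"
      have inj: "inj_on (to_nat_on J) F"
        using J F inj_on_subset inj_on_to_nat_on by blast
      have "sum d F = (\<Sum>n\<in>to_nat_on J ` F. e * (1/2) ^ Suc n)"
        unfolding d_def by (subst sum.reindex [OF inj]) simp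
      also have "\<dots> \<le> (\<Sum>n. e * (1/2) ^ Suc n)"
        using F e by (intro sum_le_suminf) (auto intro!: summable_mult)
      also have "\<dots> = e"
        using sums_mult [OF power_half_series, of e] by (simp add: sums_iff)
      finally show "(\<Sum>j\<in>F. ennreal (d j)) \<le> ennreal e"
        using d by (simp add: less_imp_le ennreal_leI)
    qed
    finally show "hausdorff_premeasure f \<rho> (\<Union>j\<in>J. A j) \<le> infsum ?p J + ennreal e"
      by (simp add: add_left_mono)
  qed
qed

lemma hausdorff_measure_UN_le:
  fixes A :: "'b \<Rightarrow> 'a::metric_space set"
  assumes J: "countable J"
  shows "hausdorff_measure f (\<Union>j\<in>J. A j) \<le> infsum (\<lambda>j. hausdorff_measure f (A j)) J"
  unfolding hausdorff_measure_def [of f "\<Union>j\<in>J. A j"]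
proof (rule SUP_least)
  fix \<rho> :: real assume "\<rho> \<in> {0<..}"
  then have "infsum (\<lambda>j. hausdorff_premeasure f \<rho> (A j)) J \<le> infsum (\<lambda>j. hausdorff_measure f (A j)) J"
    by (intro infsum_mono hausdorff_premeasure_le_measure) auto
  with hausdorff_premeasure_UN_le [OF J]
  show "hausdorff_premeasure f \<rho> (\<Union>j\<in>J. A j) \<le> infsum (\<lambda>j. hausdorff_measure f (A j)) J"
    by (rule order_trans)
qed

lemma hausdorff_measure_Un_le:
  "hausdorff_measure f (A \<union> B) \<le> hausdorff_measure f A + hausdorff_measure f B"
  using hausdorff_measure_UN_le [of "{True, False}" f "\<lambda>b. if b then A else B"]
  by (simp add: Un_commute add.commute)

lemma hausdorff_measure_UN_finite_le:
  assumes "finite J"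
  shows "hausdorff_measure f (\<Union>j\<in>J. A j) \<le> (\<Sum>j\<in>J. hausdorff_measure f (A j))"
  using hausdorff_measure_UN_le [of J f A] assms by (simp add: countable_finite)

lemma hausdorff_measure_UN_null:
  assumes "countable J" "\<And>j. j \<in> J \<Longrightarrow> hausdorff_measure f (A j) = 0"
  shows "hausdorff_measure f (\<Union>j\<in>J. A j) = 0"
proof -
  have "infsum (\<lambda>j. hausdorff_measure f (A j)) J = 0"
    using assms(2) by (simp add: infsum_0)
  with hausdorff_measure_UN_le [OF assms(1), of f A] show ?thesis by simp
qed

text \<open>Balls of radius less than half the distance of two sets meet at most one of them, so a
  fine cover of the union splits into covers of the two sets.\<close>

lemma hausdorff_measure_separated:
  fixes A B :: "'a::metric_space set"
  assumes d: "d > 0" "\<And>a b. a \<in> A \<Longrightarrow> b \<in> B \<Longrightarrow> d \<le> dist a b"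
  shows "hausdorff_measure f A + hausdorff_measure f B \<le> hausdorff_measure f (A \<union> B)"
proof -
  have pre: "hausdorff_premeasure f \<rho> A + hausdorff_premeasure f \<rho> B \<le> hausdorff_premeasure f \<rho> (A \<union> B)"
    if \<rho>: "0 < \<rho>" "2 * \<rho> < d" for \<rho>
    unfolding hausdorff_premeasure_def [of f \<rho> "A \<union> B"]
  proof (rule INF_greatest)
    fix C assume C: "C \<in> ball_covers \<rho> (A \<union> B)"
    define CA where "CA = {(x, r) \<in> C. cball x r \<inter> A \<noteq> {}}"
    define CB where "CB = {(x, r) \<in> C. cball x r \<inter> B \<noteq> {}}"
    have "CA \<in> ball_covers \<rho> A" "CB \<in> ball_covers \<rho> B"
    proof -
      have "countable CA" "countable CB"
        using C by (auto simp: ball_covers_def CA_def CB_def intro: countable_subset [of _ C])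
      moreover have "A \<subseteq> (\<Union>(x, r)\<in>CA. cball x r)" "B \<subseteq> (\<Union>(x, r)\<in>CB. cball x r)"
        using C by (fastforce simp: ball_covers_def CA_def CB_def)+
      ultimately show "CA \<in> ball_covers \<rho> A" "CB \<in> ball_covers \<rho> B"
        using C by (auto simp: ball_covers_def CA_def CB_def)
    qed
    then have "hausdorff_premeasure f \<rho> A + hausdorff_premeasure f \<rho> B
       \<le> infsum (\<lambda>(x, r). ennreal (f r)) CA + infsum (\<lambda>(x, r). ennreal (f r)) CB"
      by (intro add_mono hausdorff_premeasure_le)
    also have "CA \<inter> CB = {}"
    proof -
      have False if "(x, r) \<in> C" "a \<in> cball x r" "a \<in> A" "b \<in> cball x r" "b \<in> B" for x r a b
      proof -
        have "r \<le> \<rho>" using that C by (auto simp: ball_covers_def)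
        moreover have "dist a b \<le> dist x a + dist x b" by (metis dist_commute dist_triangle)
        ultimately show False using that d(2) [of a b] \<rho> by auto
      qed
      then show ?thesis unfolding CA_def CB_def by blast
    qed
    then have "infsum (\<lambda>(x, r). ennreal (f r)) CA + infsum (\<lambda>(x, r). ennreal (f r)) CB
       = infsum (\<lambda>(x, r). ennreal (f r)) (CA \<union> CB)"
      by (intro infsum_Un_disjoint [symmetric]) auto
    also have "\<dots> \<le> infsum (\<lambda>(x, r). ennreal (f r)) C"
      by (rule infsum_mono_neutral) (auto simp: CA_def CB_def)
    finally show "hausdorff_premeasure f \<rho> A + hausdorff_premeasure f \<rho> B
       \<le> infsum (\<lambda>(x, r). ennreal (f r)) C" .
  qed
  have "hausdorff_measure f A + hausdorff_measure f B
     = (SUP \<rho>\<in>{0<..}. hausdorff_premeasure f \<rho> A + hausdorff_premeasure f \<rho> B)"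
    unfolding hausdorff_measure_def
  proof (rule SUP_add_directed_ennreal [symmetric])
    fix i j :: real assume "i \<in> {0<..}" "j \<in> {0<..}"
    then show "\<exists>k\<in>{0<..}. hausdorff_premeasure f i A + hausdorff_premeasure f j B
      \<le> hausdorff_premeasure f k A + hausdorff_premeasure f k B"
      by (intro bexI [of _ "min i j"] add_mono hausdorff_premeasure_antimono) auto
  qed
  also have "\<dots> \<le> hausdorff_measure f (A \<union> B)"
  proof (rule SUP_least)
    fix \<rho> :: real assume "\<rho> \<in> {0<..}"
    define \<rho>' where "\<rho>' = min \<rho> (d / 3)"
    have \<rho>': "0 < \<rho>'" "2 * \<rho>' < d" "\<rho>' \<le> \<rho>"
      using \<open>\<rho> \<in> {0<..}\<close> d(1) by (auto simp: \<rho>'_def min_def)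
    have "hausdorff_premeasure f \<rho> A + hausdorff_premeasure f \<rho> B
        \<le> hausdorff_premeasure f \<rho>' A + hausdorff_premeasure f \<rho>' B"
      by (intro add_mono hausdorff_premeasure_antimono \<rho>')
    also have "\<dots> \<le> hausdorff_premeasure f \<rho>' (A \<union> B)" by (rule pre [OF \<rho>'(1,2)])
    also have "\<dots> \<le> hausdorff_measure f (A \<union> B)"
      by (rule hausdorff_premeasure_le_measure [OF \<rho>'(1)])
    finally show "hausdorff_premeasure f \<rho> A + hausdorff_premeasure f \<rho> B
        \<le> hausdorff_measure f (A \<union> B)" .
  qed
  finally show ?thesis .
qed

lemma hausdorff_measure_sum_separated:
  fixes A :: "'b \<Rightarrow> 'a::metric_space set"
  assumes "finite J"
    and sep: "\<And>i j. i \<in> J \<Longrightarrow> j \<in> J \<Longrightarrow> i \<noteq> j \<Longrightarrow> \<exists>d>0. \<forall>a\<in>A i. \<forall>b\<in>A j. d \<le> dist a b"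
  shows "(\<Sum>j\<in>J. hausdorff_measure f (A j)) \<le> hausdorff_measure f (\<Union>j\<in>J. A j)"
  using assms
proof (induction J)
  case empty
  then show ?case by simp
next
  case (insert i J)
  have "\<forall>j\<in>J. \<exists>d>0. \<forall>a\<in>A i. \<forall>b\<in>A j. d \<le> dist a b"
    using insert.hyps insert.prems by (metis insertCI)
  then obtain d where d: "\<And>j. j \<in> J \<Longrightarrow> d j > 0"
    "\<And>j a b. j \<in> J \<Longrightarrow> a \<in> A i \<Longrightarrow> b \<in> A j \<Longrightarrow> d j \<le> dist a b"
    by metis
  define e where "e = Min (insert 1 (d ` J))"
  have e: "e > 0" "\<And>j. j \<in> J \<Longrightarrow> e \<le> d j"
    using insert.hyps d(1) by (auto simp: e_def)
  have "(\<Sum>j\<in>insert i J. hausdorff_measure f (A j))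
      \<le> hausdorff_measure f (A i) + hausdorff_measure f (\<Union>j\<in>J. A j)"
    using insert by (simp add: add_left_mono)
  also have "\<dots> \<le> hausdorff_measure f (A i \<union> (\<Union>j\<in>J. A j))"
    by (rule hausdorff_measure_separated [OF e(1)]) (use d(2) e(2) in \<open>force intro: order_trans\<close>)
  finally show ?case by simp
qed

lemma hausdorff_measure_null_transfer:
  assumes fg: "\<delta> > 0" "M \<ge> 0" "\<And>t. 0 < t \<Longrightarrow> t \<le> \<delta> \<Longrightarrow> f t \<le> M * g t"
    and null: "hausdorff_measure g A = 0"
  shows "hausdorff_measure f A = 0"
proof -
  have "hausdorff_premeasure f \<rho> A \<le> 0" if "\<rho> > 0" for \<rho>
  proof -
    define \<rho>' where "\<rho>' = min \<rho> \<delta>"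
    have \<rho>': "\<rho>' > 0" "\<rho>' \<le> \<rho>" "\<rho>' \<le> \<delta>" using that fg(1) by (auto simp: \<rho>'_def)
    have *: "hausdorff_premeasure f \<rho>' A \<le> ennreal M * infsum (\<lambda>(x, r). ennreal (g r)) C"
      if C: "C \<in> ball_covers \<rho>' A" for C
    proof -
      have "hausdorff_premeasure f \<rho>' A \<le> infsum (\<lambda>(x, r). ennreal (f r)) C"
        by (rule hausdorff_premeasure_le [OF C])
      also have "\<dots> \<le> infsum (\<lambda>z. ennreal M * (case z of (x, r) \<Rightarrow> ennreal (g r))) C"
      proof (intro infsum_mono)
        fix z assume "z \<in> C"
        then obtain x r where z: "z = (x, r)" "0 < r" "r \<le> \<delta>"
          using C \<rho>' by (cases z) (auto simp: ball_covers_def)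
        then show "(case z of (x, r) \<Rightarrow> ennreal (f r)) \<le> ennreal M * (case z of (x, r) \<Rightarrow> ennreal (g r))"
          using fg(2) fg(3) [of r] by (simp add: ennreal_mult' [symmetric] ennreal_leI)
      qed auto
      also have "\<dots> \<le> ennreal M * infsum (\<lambda>(x, r). ennreal (g r)) C"
      proof (rule infsum_ennreal_leI)
        fix F assume "finite F" "F \<subseteq> C"
        then show "(\<Sum>z\<in>F. ennreal M * (case z of (x, r) \<Rightarrow> ennreal (g r)))
            \<le> ennreal M * infsum (\<lambda>(x, r). ennreal (g r)) C"
          unfolding sum_distrib_left [symmetric]
          by (intro mult_left_mono sum_le_infsum_ennreal) auto
      qed
      finally show ?thesis .
    qed
    have "hausdorff_premeasure g \<rho>' A = 0"
      using hausdorff_premeasure_le_measure [OF \<rho>'(1), of g A] null by simp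
    have "hausdorff_premeasure f \<rho>' A \<le> 0 + ennreal e" if "e > 0" for e
    proof -
      have "hausdorff_premeasure g \<rho>' A < ennreal (e / (M + 1))"
        using that fg(2) \<open>hausdorff_premeasure g \<rho>' A = 0\<close> by simp
      then obtain C where C: "C \<in> ball_covers \<rho>' A"
        "infsum (\<lambda>(x, r). ennreal (g r)) C < ennreal (e / (M + 1))"
        unfolding hausdorff_premeasure_def INF_less_iff by blast
      have "hausdorff_premeasure f \<rho>' A \<le> ennreal M * ennreal (e / (M + 1))"
        using * [OF C(1)] C(2) by (meson less_imp_le mult_left_mono order_trans zero_le)
      also have "\<dots> = ennreal (M * (e / (M + 1)))"
        using fg(2) by (rule ennreal_mult' [symmetric])
      also have "\<dots> \<le> ennreal e"
        using fg(2) that by (intro ennreal_leI) (simp add: field_simps)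
      finally show ?thesis by simp
    qed
    then have "hausdorff_premeasure f \<rho>' A \<le> 0"
      by (rule ennreal_le_epsilon)
    with hausdorff_premeasure_antimono [OF \<rho>'(2), of f A] show ?thesis by simp
  qed
  then have "hausdorff_measure f A \<le> 0"
    unfolding hausdorff_measure_def by (intro SUP_least) auto
  then show ?thesis by simp
qed

section \<open>The Vitali covering lemma\<close>

text \<open>The families \<open>J\<close> to which the lemma of Zorn is applied are disjoint and have the property that
  every ball meeting a member of \<open>J\<close> meets a member of at least half its own radius. A maximal such
  family meets every ball: otherwise a ball of nearly maximal radius among those disjoint
  from \<open>J\<close> could be added.\<close>

lemma vitali_disjoint_subfamily:
  fixes c :: "'b \<Rightarrow> 'a::metric_space"
  assumes pos: "\<And>i. i \<in> I \<Longrightarrow> 0 < R i" and bdd: "\<And>i. i \<in> I \<Longrightarrow> R i \<le> M"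
  obtains J where "J \<subseteq> I" "disjoint_family_on (\<lambda>i. cball (c i) (R i)) J"
    "\<And>i. i \<in> I \<Longrightarrow> \<exists>j\<in>J. cball (c i) (R i) \<subseteq> cball (c j) (5 * R j)"
proof -
  define B where "B i = cball (c i) (R i)" for i
  define \<Omega> where "\<Omega> = {J. J \<subseteq> I \<and> disjoint_family_on B J \<and>
     (\<forall>i\<in>I. (\<exists>j\<in>J. B i \<inter> B j \<noteq> {}) \<longrightarrow> (\<exists>j\<in>J. B i \<inter> B j \<noteq> {} \<and> R i \<le> 2 * R j))}"
  have "\<exists>J\<in>\<Omega>. \<forall>X\<in>\<Omega>. J \<subseteq> X \<longrightarrow> X = J"
  proof (rule subset_Zorn')
    fix C assume C: "subset.chain \<Omega> C"
    have sub: "C \<subseteq> \<Omega>" using C by (simp add: subset.chain_def)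
    have "disjoint_family_on B (\<Union>C)"
      unfolding disjoint_family_on_def
    proof (intro ballI impI)
      fix i j assume ij: "i \<in> \<Union>C" "j \<in> \<Union>C" "i \<noteq> j"
      then obtain J where "J \<in> C" "i \<in> J" "j \<in> J"
        using C unfolding subset_chain_def by blast
      then show "B i \<inter> B j = {}"
        using sub ij(3) unfolding \<Omega>_def disjoint_family_on_def by blast
    qed
    moreover have "\<exists>j\<in>\<Union>C. B i \<inter> B j \<noteq> {} \<and> R i \<le> 2 * R j"
      if i: "i \<in> I" "\<exists>j\<in>\<Union>C. B i \<inter> B j \<noteq> {}" for i
    proof -
      obtain J where J: "J \<in> C" "\<exists>j\<in>J. B i \<inter> B j \<noteq> {}" using i(2) by blast
      then have "\<exists>j\<in>J. B i \<inter> B j \<noteq> {} \<and> R i \<le> 2 * R j"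
        using sub i(1) unfolding \<Omega>_def by blast
      then show ?thesis using J(1) by blast
    qed
    moreover have "\<Union>C \<subseteq> I" using sub unfolding \<Omega>_def by blast
    ultimately show "\<Union>C \<in> \<Omega>" unfolding \<Omega>_def by blast
  qed
  then obtain J where J: "J \<in> \<Omega>" and max: "\<And>X. X \<in> \<Omega> \<Longrightarrow> J \<subseteq> X \<Longrightarrow> X = J" by blast
  have JI: "J \<subseteq> I" and dis: "disjoint_family_on B J"
    and big: "\<And>i. i \<in> I \<Longrightarrow> \<exists>j\<in>J. B i \<inter> B j \<noteq> {} \<Longrightarrow> \<exists>j\<in>J. B i \<inter> B j \<noteq> {} \<and> R i \<le> 2 * R j"
    using J unfolding \<Omega>_def by blast+
  have meets: "\<exists>j\<in>J. B i \<inter> B j \<noteq> {}" if "i \<in> I" for i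
  proof (rule ccontr)
    define N where "N = {i\<in>I. \<forall>j\<in>J. B i \<inter> B j = {}}"
    assume "\<not> ?thesis"
    then have iN: "i \<in> N" using that by (auto simp: N_def)
    have bdd': "bdd_above (R ` N)" using bdd by (auto simp: N_def bdd_above_def)
    have "R i \<le> Sup (R ` N)" using iN bdd' by (auto intro: cSup_upper)
    moreover have "R i > 0" using iN pos by (auto simp: N_def)
    ultimately have "Sup (R ` N) / 2 < Sup (R ` N)" by simp
    \<comment> \<open>a ball whose radius is within a factor \<open>2\<close> of the supremum among the remaining balls\<close>
    then obtain k where k: "k \<in> N" "Sup (R ` N) / 2 < R k"
      using iN bdd' by (subst (asm) less_cSup_iff) auto
    have kB: "c k \<in> B k" using k(1) pos [of k] by (auto simp: N_def B_def)
    then have "k \<notin> J" using k(1) by (auto simp: N_def)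
    have "insert k J \<in> \<Omega>"
      unfolding \<Omega>_def
    proof (intro CollectI conjI ballI impI)
      show "insert k J \<subseteq> I" using JI k(1) by (auto simp: N_def)
      show "disjoint_family_on B (insert k J)"
        using dis k(1) unfolding disjoint_family_on_def N_def by blast
      fix l assume l: "l \<in> I" "\<exists>j\<in>insert k J. B l \<inter> B j \<noteq> {}"
      show "\<exists>j\<in>insert k J. B l \<inter> B j \<noteq> {} \<and> R l \<le> 2 * R j"
      proof (cases "l \<in> N")
        case True
        then have "R l \<le> Sup (R ` N)" using bdd' by (auto intro: cSup_upper)
        moreover have "B l \<inter> B k \<noteq> {}" using l(2) True by (auto simp: N_def)
        ultimately show ?thesis using k(2) by force
      next
        case False
        then show ?thesis using big [OF l(1)] l(1) by (auto simp: N_def)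
      qed
    qed
    then have "insert k J = J" by (rule max) blast
    with \<open>k \<notin> J\<close> show False by blast
  qed
  show thesis
  proof
    show "J \<subseteq> I" by (rule JI)
    show "disjoint_family_on (\<lambda>i. cball (c i) (R i)) J" using dis unfolding B_def .
    fix i assume i: "i \<in> I"
    then obtain j where j: "j \<in> J" "B i \<inter> B j \<noteq> {}" "R i \<le> 2 * R j"
      using big meets by blast
    then obtain p where p: "dist (c i) p \<le> R i" "dist (c j) p \<le> R j" by (auto simp: B_def)
    have "dist (c j) q \<le> 5 * R j" if "dist (c i) q \<le> R i" for q
    proof -
      have "dist (c j) q \<le> dist (c j) p + dist (c i) p + dist (c i) q"
        by (metis dist_commute dist_triangle dist_triangle_le add.assoc add_left_mono)
      then show ?thesis using p that j(3) by linarith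
    qed
    then show "\<exists>j\<in>J. cball (c i) (R i) \<subseteq> cball (c j) (5 * R j)"
      using j(1) by (auto intro!: bexI [of _ j])
  qed
qed

lemma countable_disjoint_cballs:
  fixes c :: "'b \<Rightarrow> 'a::metric_space" and D :: "'a set"
  assumes D: "countable D" "\<And>y e. e > 0 \<Longrightarrow> \<exists>d\<in>D. dist y d < e"
    and J: "disjoint_family_on (\<lambda>j. cball (c j) (R j)) J" "\<And>j. j \<in> J \<Longrightarrow> 0 < R j"
  shows "countable J"
proof -
  have "\<forall>j\<in>J. \<exists>d. d \<in> D \<and> d \<in> cball (c j) (R j)"
    using D(2) J(2) by (meson less_imp_le mem_cball)
  then obtain h where h: "\<And>j. j \<in> J \<Longrightarrow> h j \<in> D \<and> h j \<in> cball (c j) (R j)" by metis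
  have "inj_on h J"
    using J(1) h unfolding inj_on_def disjoint_family_on_def by (metis disjoint_iff)
  moreover have "h ` J \<subseteq> D" using h by blast
  ultimately show ?thesis using D(1) countable_image_inj_on countable_subset by blast
qed

section \<open>Gauges with a regular Hausdorff measure\<close>

text \<open>A doubling gauge \<open>g\<close> whose Hausdorff measure of a ball of small radius \<open>t\<close> is comparable
  to \<open>g t\<close>, on a space with a countable dense set \<open>D\<close>. The constant \<open>lam\<close> is a doubling constant of \<open>g\<close>.\<close>

locale regular_gauge =
  fixes g :: "real \<Rightarrow> real" and lam c1 c2 r0 :: real and D :: "'a::metric_space set"
  assumes g_pos: "0 < t \<Longrightarrow> 0 < g t"
    and g_mono: "0 < t \<Longrightarrow> t \<le> u \<Longrightarrow> g t \<le> g u"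
    and g_double: "0 < t \<Longrightarrow> g (2 * t) \<le> lam * g t"
    and lam: "1 < lam" and c1: "0 < c1" and c2: "0 < c2" and r0: "0 < r0"
    and countable_D: "countable D"
    and dense_D: "\<And>y e. 0 < e \<Longrightarrow> \<exists>d\<in>D. dist y d < e"
    and lower: "\<And>(y::'a) t. 0 < t \<Longrightarrow> t \<le> r0 \<Longrightarrow> ennreal (c1 * g t) \<le> hausdorff_measure g (cball y t)"
    and upper: "\<And>(y::'a) t. 0 < t \<Longrightarrow> t \<le> r0 \<Longrightarrow> hausdorff_measure g (cball y t) \<le> ennreal (c2 * g t)"
begin

abbreviation \<mu> :: "'a set \<Rightarrow> ennreal" where
  "\<mu> \<equiv> hausdorff_measure g"

lemma g_double_power: "0 < t \<Longrightarrow> g (2 ^ n * t) \<le> lam ^ n * g t"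
proof (induction n)
  case (Suc n)
  have "g (2 ^ Suc n * t) \<le> lam * g (2 ^ n * t)"
    using g_double [of "2 ^ n * t"] Suc.prems by (simp add: mult.assoc)
  also have "\<dots> \<le> lam * (lam ^ n * g t)"
    using Suc lam by (intro mult_left_mono) auto
  finally show ?case by (simp add: mult.assoc)
qed simp

lemma g_le_8: "0 < t \<Longrightarrow> 0 < u \<Longrightarrow> u \<le> 8 * t \<Longrightarrow> g u \<le> lam ^ 3 * g t"
  using g_double_power [of t 3] g_mono [of u "8 * t"] by simp

lemma g_half: "0 < t \<Longrightarrow> g t \<le> lam * g (t / 2)"
  using g_double [of "t / 2"] by simp

text \<open>The Vitali covering lemma in terms of the measure: some countable disjoint subfamily covers \<open>E\<close>
  after enlargement by the factor \<open>5 \<le> 2\<^sup>3\<close>, which costs three doublings.\<close>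

lemma measure_le_disjoint_sums:
  fixes c :: "'b \<Rightarrow> 'a"
  assumes R: "\<And>i. i \<in> I \<Longrightarrow> 0 < R i" "\<And>i. i \<in> I \<Longrightarrow> 5 * R i \<le> r0"
    and cover: "E \<subseteq> (\<Union>i\<in>I. cball (c i) (R i))"
    and T: "\<And>J. finite J \<Longrightarrow> J \<subseteq> I \<Longrightarrow> disjoint_family_on (\<lambda>i. cball (c i) (R i)) J
              \<Longrightarrow> (\<Sum>j\<in>J. g (R j)) \<le> T"
  shows "\<mu> E \<le> ennreal (c2 * lam ^ 3 * T)"
proof -
  obtain J where J: "J \<subseteq> I" "disjoint_family_on (\<lambda>i. cball (c i) (R i)) J"
    "\<And>i. i \<in> I \<Longrightarrow> \<exists>j\<in>J. cball (c i) (R i) \<subseteq> cball (c j) (5 * R j)"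
    by (rule vitali_disjoint_subfamily [of I R "r0 / 5" c]) (use R in force)+
  have "countable J"
    by (rule countable_disjoint_cballs [OF countable_D dense_D J(2)]) (use J(1) R(1) in auto)
  have "\<mu> E \<le> \<mu> (\<Union>j\<in>J. cball (c j) (5 * R j))"
    by (rule hausdorff_measure_mono) (use cover J(3) in blast)
  also have "\<dots> \<le> infsum (\<lambda>j. \<mu> (cball (c j) (5 * R j))) J"
    by (rule hausdorff_measure_UN_le [OF \<open>countable J\<close>])
  also have "\<dots> \<le> infsum (\<lambda>j. ennreal (c2 * lam ^ 3 * g (R j))) J"
  proof (rule infsum_mono)
    fix j assume "j \<in> J"
    then have j: "0 < R j" "5 * R j \<le> r0" using J(1) R by auto
    have "\<mu> (cball (c j) (5 * R j)) \<le> ennreal (c2 * g (5 * R j))"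
      using j by (intro upper) auto
    also have "\<dots> \<le> ennreal (c2 * lam ^ 3 * g (R j))"
      using g_le_8 [of "R j" "5 * R j"] j c2 by (simp add: ennreal_leI)
    finally show "\<mu> (cball (c j) (5 * R j)) \<le> \<dots>" .
  qed auto
  also have "\<dots> \<le> ennreal (c2 * lam ^ 3 * T)"
  proof (rule infsum_ennreal_leI)
    fix F assume F: "finite F" "F \<subseteq> J"
    then have "(\<Sum>j\<in>F. g (R j)) \<le> T"
      using J(1,2) by (intro T) (auto intro: disjoint_family_on_mono)
    then have "(\<Sum>j\<in>F. c2 * lam ^ 3 * g (R j)) \<le> c2 * lam ^ 3 * T"
      using c2 lam by (simp add: sum_distrib_left [symmetric])
    moreover have "(\<Sum>j\<in>F. ennreal (c2 * lam ^ 3 * g (R j))) = ennreal (\<Sum>j\<in>F. c2 * lam ^ 3 * g (R j))"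
      using F J(1) R(1) c2 lam g_pos by (intro sum_ennreal) (auto simp: less_imp_le subset_eq)
    ultimately show "(\<Sum>j\<in>F. ennreal (c2 * lam ^ 3 * g (R j))) \<le> ennreal (c2 * lam ^ 3 * T)"
      by (simp add: ennreal_leI)
  qed
  finally show ?thesis .
qed

text \<open>Disjoint closed balls may have distance zero in a space that is not proper; concentric
  balls of half the radius do not.\<close>

lemma disjoint_cballs_separated:
  fixes c :: "'b \<Rightarrow> 'a"
  assumes "cball (c i) (R i) \<inter> cball (c j) (R j) = {}" "0 < R i" "0 < R j"
  shows "\<exists>d>0. \<forall>a\<in>cball (c i) (R i / 2). \<forall>b\<in>cball (c j) (R j / 2). d \<le> dist a b"
proof (intro exI [of _ "min (R i) (R j) / 2"] conjI ballI)
  fix a b assume ab: "a \<in> cball (c i) (R i / 2)" "b \<in> cball (c j) (R j / 2)"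
  have "b \<notin> cball (c i) (R i)" using ab(2) assms by auto
  moreover have "dist (c i) b \<le> dist (c i) a + dist a b" by (rule dist_triangle)
  ultimately show "min (R i) (R j) / 2 \<le> dist a b" using ab(1) by auto
qed (use assms in auto)

lemma sum_half_balls_le:
  fixes c :: "'b \<Rightarrow> 'a"
  assumes J: "finite J" "disjoint_family_on (\<lambda>i. cball (c i) (R i)) J"
    and R: "\<And>i. i \<in> J \<Longrightarrow> 0 < R i" "\<And>i. i \<in> J \<Longrightarrow> R i \<le> r0"
  shows "ennreal (c1 / lam * (\<Sum>j\<in>J. g (R j))) \<le> \<mu> (\<Union>j\<in>J. cball (c j) (R j / 2))"
proof -
  have "c1 / lam * (\<Sum>j\<in>J. g (R j)) \<le> (\<Sum>j\<in>J. c1 * g (R j / 2))"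
    unfolding sum_distrib_left
    using g_half R(1) lam c1 by (intro sum_mono) (simp add: field_simps)
  then have "ennreal (c1 / lam * (\<Sum>j\<in>J. g (R j))) \<le> ennreal (\<Sum>j\<in>J. c1 * g (R j / 2))"
    by (rule ennreal_leI)
  also have "\<dots> = (\<Sum>j\<in>J. ennreal (c1 * g (R j / 2)))"
    by (rule sum_ennreal [symmetric]) (use R c1 g_pos in \<open>simp add: less_imp_le\<close>)
  also have "\<dots> \<le> (\<Sum>j\<in>J. \<mu> (cball (c j) (R j / 2)))"
  proof (intro sum_mono lower)
    fix j assume "j \<in> J"
    with R [of j] show "0 < R j / 2" "R j / 2 \<le> r0" by auto
  qed
  also have "\<dots> \<le> \<mu> (\<Union>j\<in>J. cball (c j) (R j / 2))"
    using J R by (intro hausdorff_measure_sum_separated disjoint_cballs_separated)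
      (auto simp: disjoint_family_on_def)
  finally show ?thesis .
qed

text \<open>Disjoint balls inside a ball of radius \<open>t\<close> have \<open>g\<close>-sum at most a constant times \<open>g t\<close>.\<close>

lemma packing:
  fixes c :: "'b \<Rightarrow> 'a"
  assumes J: "finite J" "disjoint_family_on (\<lambda>i. cball (c i) (R i)) J"
    and R: "\<And>i. i \<in> J \<Longrightarrow> 0 < R i" "\<And>i. i \<in> J \<Longrightarrow> R i \<le> r0"
    and sub: "\<And>i. i \<in> J \<Longrightarrow> cball (c i) (R i) \<subseteq> cball a t" and t: "0 < t" "t \<le> r0"
  shows "(\<Sum>j\<in>J. g (R j)) \<le> lam * c2 / c1 * g t"
proof -
  have "ennreal (c1 / lam * (\<Sum>j\<in>J. g (R j))) \<le> \<mu> (\<Union>j\<in>J. cball (c j) (R j / 2))"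
    by (rule sum_half_balls_le [OF J R])
  also have "\<dots> \<le> \<mu> (cball a t)"
  proof (intro hausdorff_measure_mono UN_least)
    fix i assume "i \<in> J"
    with R(1) [of i] have "cball (c i) (R i / 2) \<subseteq> cball (c i) (R i)" by (intro subset_cball) auto
    with sub \<open>i \<in> J\<close> show "cball (c i) (R i / 2) \<subseteq> cball a t" by blast
  qed
  also have "\<dots> \<le> ennreal (c2 * g t)" by (rule upper [OF t])
  finally have "c1 / lam * (\<Sum>j\<in>J. g (R j)) \<le> c2 * g t"
    using c2 g_pos [OF t(1)] by (simp add: ennreal_le_iff less_imp_le)
  then show ?thesis using c1 lam by (simp add: field_simps)
qed

end

section \<open>Disjoint balls of a limsup set of full measure\<close>

text \<open>The balls \<open>cball (x i) (s i)\<close> stand for the enlarged balls \<open>B\<^sub>i\<^sup>f\<close>, whose limsup has full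
  measure in every ball.\<close>

locale full_limsup = regular_gauge g lam c1 c2 r0 D
  for g lam c1 c2 r0 and D :: "'a::metric_space set" +
  fixes x :: "nat \<Rightarrow> 'a" and s :: "nat \<Rightarrow> real"
  assumes s_pos: "0 < s i" and s_lim: "s \<longlonglongrightarrow> 0"
    and full: "\<And>y t. 0 < t \<Longrightarrow> \<mu> (cball y t \<inter> limsup (\<lambda>i. cball (x i) (s i))) = \<mu> (cball y t)"
begin

text \<open>The proportion of the measure of an open set that a disjoint family of balls inside it can
  reach. Each of the two uses of the covering lemma contributes a factor
  \<open>1 / (c2 * lam ^ 3)\<close>, and the passage to a half ball the factor \<open>c1 / lam\<close>; the factor \<open>4\<close> leaves room for
  strict inequalities.\<close>

definition \<kappa> :: real where
  "\<kappa> = c1 / (4 * lam * (c2 * lam ^ 3)\<^sup>2)"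

lemma \<kappa>_pos: "0 < \<kappa>"
  using c1 c2 lam by (simp add: \<kappa>_def)

lemma s_less_from:
  assumes "e > 0" obtains N where "N \<ge> G" "\<And>i. i \<ge> N \<Longrightarrow> s i < e"
proof -
  have "\<forall>\<^sub>F i in sequentially. s i < e"
    using order_tendstoD(2) [OF s_lim assms] .
  then obtain N where "\<And>i. i \<ge> N \<Longrightarrow> s i < e" unfolding eventually_sequentially by blast
  then show thesis by (intro that [of "max N G"]) auto
qed

text \<open>The balls \<open>cball (x i) (s i)\<close> with \<open>s i < t / 5\<close> that meet the ball of radius \<open>t / 2\<close> lie in
  the ball of radius \<open>t\<close>, and those with large indices cover a subset of the smaller ball that has the same measure.
  The covering lemma therefore selects enough of them.\<close>

lemma ball_contains_disjoint_balls:
  assumes t: "0 < t" "t \<le> r0"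
  obtains J where "finite J" "J \<subseteq> {G..}" "disjoint_family_on (\<lambda>i. cball (x i) (s i)) J"
    "\<And>j. j \<in> J \<Longrightarrow> cball (x j) (s j) \<subseteq> cball y t"
    "2 * \<kappa> * (c2 * lam ^ 3) * g t < (\<Sum>j\<in>J. g (s j))"
proof (rule ccontr)
  assume no: "\<not> thesis"
  obtain N where N: "N \<ge> G" "\<And>i. i \<ge> N \<Longrightarrow> s i < t / 5" by (rule s_less_from [of "t/5" G]) (use t in auto)
  define I where "I = {i. i \<ge> N \<and> cball (x i) (s i) \<subseteq> cball y t}"
  define T where "T = 2 * \<kappa> * (c2 * lam ^ 3) * g t"
  have "\<mu> (cball y (t / 2) \<inter> limsup (\<lambda>i. cball (x i) (s i))) \<le> ennreal (c2 * lam ^ 3 * T)"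
  proof (rule measure_le_disjoint_sums [of I s _ x])
    fix i assume "i \<in> I"
    then show "0 < s i" "5 * s i \<le> r0" using N(2) [of i] t s_pos by (auto simp: I_def)
  next
    show "cball y (t / 2) \<inter> limsup (\<lambda>i. cball (x i) (s i)) \<subseteq> (\<Union>i\<in>I. cball (x i) (s i))"
    proof
      fix p assume p: "p \<in> cball y (t / 2) \<inter> limsup (\<lambda>i. cball (x i) (s i))"
      then obtain i where i: "i \<ge> N" "p \<in> cball (x i) (s i)"
        unfolding limsup_INF_SUP by auto
      have "dist y q \<le> t" if "dist (x i) q \<le> s i" for q
      proof -
        have "dist y q \<le> dist y p + dist (x i) p + dist (x i) q"
          by (metis dist_commute dist_triangle dist_triangle_le add.assoc add_left_mono)
        then show ?thesis using that p i(2) N(2) [OF i(1)] t by auto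
      qed
      then have "i \<in> I" using i(1) by (auto simp: I_def)
      then show "p \<in> (\<Union>i\<in>I. cball (x i) (s i))" using i(2) by blast
    qed
  next
    fix J assume J: "finite J" "J \<subseteq> I" "disjoint_family_on (\<lambda>i. cball (x i) (s i)) J"
    then have "J \<subseteq> {G..}" "\<And>j. j \<in> J \<Longrightarrow> cball (x j) (s j) \<subseteq> cball y t"
      using N(1) by (auto simp: I_def)
    then have "\<not> T < (\<Sum>j\<in>J. g (s j))"
      using no that J unfolding T_def by metis
    then show "(\<Sum>j\<in>J. g (s j)) \<le> T" by simp
  qed
  also have "c2 * lam ^ 3 * T = c1 / lam * g t / 2"
  proof -
    have "0 < c2 * lam ^ 3" using c2 lam by simp
    then show ?thesis
      unfolding T_def \<kappa>_def power2_eq_square using c2 by (simp add: divide_simps mult_ac)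
  qed
  finally have "\<mu> (cball y (t / 2)) \<le> ennreal (c1 / lam * g t / 2)"
    using full [of "t / 2" y] t by simp
  moreover have "ennreal (c1 * g (t / 2)) \<le> \<mu> (cball y (t / 2))"
    using t by (intro lower) auto
  ultimately have "ennreal (c1 * g (t / 2)) \<le> ennreal (c1 / lam * g t / 2)"
    by (rule order_trans [rotated])
  then have "c1 * g (t / 2) \<le> c1 / lam * g t / 2"
    using c1 lam g_pos [OF t(1)] by (subst (asm) ennreal_le_iff) auto
  then have "2 * lam * g (t / 2) \<le> g t" using c1 lam by (simp add: field_simps)
  moreover have "0 < lam * g (t / 2)" using g_pos [of "t / 2"] t lam by simp
  ultimately show False using g_half [OF t(1)] by linarith
qed

lemma open_contains_disjoint_balls:
  assumes V: "open V" and T: "0 \<le> T" "ennreal T < \<mu> V"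
  obtains J where "finite J" "J \<subseteq> {G..}" "disjoint_family_on (\<lambda>i. cball (x i) (s i)) J"
    "\<And>j. j \<in> J \<Longrightarrow> cball (x j) (s j) \<subseteq> V" "\<kappa> * T < (\<Sum>j\<in>J. g (s j))"
proof -
  define I where "I = {(v, t). 0 < t \<and> 5 * t \<le> r0 \<and> cball v t \<subseteq> V}"
  have "\<exists>K. finite K \<and> K \<subseteq> I \<and> disjoint_family_on (\<lambda>i. cball (fst i) (snd i)) K \<and>
      T / (c2 * lam ^ 3) < (\<Sum>j\<in>K. g (snd j))"
  proof (rule ccontr)
    assume no: "\<not> ?thesis"
    have "\<mu> V \<le> ennreal (c2 * lam ^ 3 * (T / (c2 * lam ^ 3)))"
    proof (rule measure_le_disjoint_sums [of I snd _ fst])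
      show "V \<subseteq> (\<Union>i\<in>I. cball (fst i) (snd i))"
      proof
        fix v assume "v \<in> V"
        then obtain e where e: "e > 0" "cball v e \<subseteq> V" using V open_contains_cball by blast
        have "cball v (min e (r0 / 5)) \<subseteq> cball v e" by (intro subset_cball) auto
        then have "(v, min e (r0 / 5)) \<in> I" using e r0 by (auto simp: I_def)
        moreover have "v \<in> cball v (min e (r0 / 5))" using e r0 by simp
        ultimately show "v \<in> (\<Union>i\<in>I. cball (fst i) (snd i))" by force
      qed
    qed (use no in \<open>auto simp: I_def not_less\<close>)
    then show False using T c2 lam by simp
  qed
  then obtain K where K: "finite K" "K \<subseteq> I" "disjoint_family_on (\<lambda>i. cball (fst i) (snd i)) K"
    "T / (c2 * lam ^ 3) < (\<Sum>j\<in>K. g (snd j))" by blast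
  have "\<forall>k\<in>K. \<exists>J. finite J \<and> J \<subseteq> {G..} \<and> disjoint_family_on (\<lambda>i. cball (x i) (s i)) J \<and>
     (\<forall>j\<in>J. cball (x j) (s j) \<subseteq> cball (fst k) (snd k)) \<and>
     2 * \<kappa> * (c2 * lam ^ 3) * g (snd k) < (\<Sum>j\<in>J. g (s j))"
  proof
    fix k assume "k \<in> K"
    then have "0 < snd k" "snd k \<le> r0" using K(2) by (auto simp: I_def)
    then show "\<exists>J. finite J \<and> J \<subseteq> {G..} \<and> disjoint_family_on (\<lambda>i. cball (x i) (s i)) J \<and>
     (\<forall>j\<in>J. cball (x j) (s j) \<subseteq> cball (fst k) (snd k)) \<and>
     2 * \<kappa> * (c2 * lam ^ 3) * g (snd k) < (\<Sum>j\<in>J. g (s j))"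
      by (rule ball_contains_disjoint_balls [of "snd k" G "fst k"]) blast
  qed
  from bchoice [OF this] obtain J where J': "\<forall>k\<in>K. finite (J k) \<and> J k \<subseteq> {G..} \<and>
     disjoint_family_on (\<lambda>i. cball (x i) (s i)) (J k) \<and>
     (\<forall>j\<in>J k. cball (x j) (s j) \<subseteq> cball (fst k) (snd k)) \<and>
     2 * \<kappa> * (c2 * lam ^ 3) * g (snd k) < (\<Sum>j\<in>J k. g (s j))" by blast
  then have J: "\<And>k. k \<in> K \<Longrightarrow> finite (J k)" "\<And>k. k \<in> K \<Longrightarrow> J k \<subseteq> {G..}"
     "\<And>k. k \<in> K \<Longrightarrow> disjoint_family_on (\<lambda>i. cball (x i) (s i)) (J k)"
     "\<And>k j. k \<in> K \<Longrightarrow> j \<in> J k \<Longrightarrow> cball (x j) (s j) \<subseteq> cball (fst k) (snd k)"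
     "\<And>k. k \<in> K \<Longrightarrow> 2 * \<kappa> * (c2 * lam ^ 3) * g (snd k) < (\<Sum>j\<in>J k. g (s j))"
    by simp_all
  have dis: "cball (x i) (s i) \<inter> cball (x j) (s j) = {}"
    if "k \<in> K" "l \<in> K" "k \<noteq> l" "i \<in> J k" "j \<in> J l" for k l i j
    using K(3) J(4) that unfolding disjoint_family_on_def by blast
  have ne: "cball (x i) (s i) \<noteq> {}" for i using s_pos [of i] by auto
  show thesis
  proof (rule that [of "\<Union>k\<in>K. J k"])
    show "finite (\<Union>k\<in>K. J k)" using K(1) J(1) by blast
    show "(\<Union>k\<in>K. J k) \<subseteq> {G..}" using J(2) by blast
    show "disjoint_family_on (\<lambda>i. cball (x i) (s i)) (\<Union>k\<in>K. J k)"
      unfolding disjoint_family_on_def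
    proof (intro ballI impI)
      fix i j assume "i \<in> (\<Union>k\<in>K. J k)" "j \<in> (\<Union>k\<in>K. J k)" "i \<noteq> j"
      then obtain k l where kl: "k \<in> K" "l \<in> K" "i \<in> J k" "j \<in> J l" by blast
      show "cball (x i) (s i) \<inter> cball (x j) (s j) = {}"
      proof (cases "k = l")
        case True
        then show ?thesis using J(3) [of k] kl \<open>i \<noteq> j\<close> unfolding disjoint_family_on_def by blast
      next
        case False
        then show ?thesis using dis kl by blast
      qed
    qed
    show "cball (x j) (s j) \<subseteq> V" if j: "j \<in> (\<Union>k\<in>K. J k)" for j
    proof -
      obtain k where k: "k \<in> K" "j \<in> J k" using j by blast
      then have "cball (fst k) (snd k) \<subseteq> V" using K(2) by (force simp: I_def)
      then show ?thesis using J(4) k by blast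
    qed
    have "\<kappa> * T \<le> 2 * \<kappa> * (c2 * lam ^ 3) * (T / (c2 * lam ^ 3))"
      using \<kappa>_pos T(1) c2 lam by simp
    also have "\<dots> < 2 * \<kappa> * (c2 * lam ^ 3) * (\<Sum>k\<in>K. g (snd k))"
      using K(4) \<kappa>_pos c2 lam by (intro mult_strict_left_mono) auto
    also have "\<dots> \<le> (\<Sum>k\<in>K. \<Sum>j\<in>J k. g (s j))"
      unfolding sum_distrib_left by (intro sum_mono less_imp_le J(5))
    also have "\<dots> = (\<Sum>j\<in>(\<Union>k\<in>K. J k). g (s j))"
    proof (rule sum.UNION_disjoint [symmetric])
      show "\<forall>k\<in>K. \<forall>l\<in>K. k \<noteq> l \<longrightarrow> J k \<inter> J l = {}"
      proof (intro ballI impI)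
        fix k l assume kl: "k \<in> K" "l \<in> K" "k \<noteq> l"
        show "J k \<inter> J l = {}"
        proof (rule ccontr)
          assume "J k \<inter> J l \<noteq> {}"
          then obtain i where "i \<in> J k" "i \<in> J l" by blast
          then show False using dis [OF kl, of i i] ne [of i] by blast
        qed
      qed
    qed (use K(1) J(1) in auto)
    finally show "\<kappa> * T < (\<Sum>j\<in>(\<Union>k\<in>K. J k). g (s j))" .
  qed
qed

section \<open>Comparable gauges\<close>

text \<open>The radii \<open>r i\<close> are those of the original balls, and the hypothesis on \<open>g (s i)\<close> says that
  enlarging them to \<open>s i\<close> increases their measure by a bounded factor only. Finitely many original
  balls then cover a fixed proportion of the open set \<open>U\<close>, and they can be removed from it. The bound
  is phrased with \<open>max 0\<close> so that it can be iterated without knowing that the proportion is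
  at most \<open>1\<close>.\<close>

lemma open_shrink_step:
  assumes r: "\<And>i. 0 < r i" and M: "1 \<le> M"
    and sr: "\<And>i. G \<le> i \<Longrightarrow> g (s i) \<le> M * g (r i)" and sG: "\<And>i. G \<le> i \<Longrightarrow> s i \<le> r0"
    and U: "open U" "\<mu> U \<le> ennreal b" "0 \<le> b"
  obtains U' where "open U'" "U - (\<Union>i\<in>{G..}. cball (x i) (r i)) \<subseteq> U'"
    "\<mu> U' \<le> ennreal (max 0 (1 - c1 * \<kappa> / (2 * lam * M)) * b)"
proof -
  define \<theta> where "\<theta> = c1 * \<kappa> / (2 * lam * M)"
  define a where "a = enn2real (\<mu> U)"
  have a: "\<mu> U = ennreal a" "0 \<le> a" "a \<le> b"
    using U(2,3) unfolding a_def
    by (auto simp: ennreal_enn2real_if top_unique intro: enn2real_leI)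
  consider "a = 0" | "0 < a" using a(2) by linarith
  then show thesis
  proof cases
    case 1
    then have "\<mu> U \<le> ennreal (max 0 (1 - \<theta>) * b)" using a(1) by simp
    then show thesis using U(1) unfolding \<theta>_def by (intro that [of U]) auto
  next
    case 2
    have half: "0 \<le> a / 2" "ennreal (a / 2) < \<mu> U" using 2 a(1) by (simp_all add: ennreal_less_iff)
    obtain J where J: "finite J" "J \<subseteq> {G..}" "disjoint_family_on (\<lambda>i. cball (x i) (s i)) J"
      "\<And>j. j \<in> J \<Longrightarrow> cball (x j) (s j) \<subseteq> U" "\<kappa> * (a / 2) < (\<Sum>j\<in>J. g (s j))"
      by (rule open_contains_disjoint_balls [OF U(1) half, of G]) blast
    \<comment> \<open>the smaller of the two radii keeps the balls disjoint and inside both \<open>U\<close> and the original balls\<close>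
    define \<rho> where "\<rho> i = min (r i) (s i)" for i
    have \<rho>: "0 < \<rho> i" "\<rho> i \<le> r i" "\<rho> i \<le> s i" for i
      using r [of i] s_pos [of i] by (auto simp: \<rho>_def)
    define K where "K = (\<Union>j\<in>J. cball (x j) (\<rho> j))"
    define H where "H = (\<Union>j\<in>J. cball (x j) (\<rho> j / 2))"
    have \<rho>s: "cball (x j) (\<rho> j) \<subseteq> cball (x j) (s j)" for j
      using \<rho> by (intro subset_cball)
    have "H \<subseteq> K"
      unfolding H_def K_def by (intro UN_mono subset_cball) (use \<rho> in \<open>auto simp: less_imp_le\<close>)
    moreover have "K \<subseteq> U" unfolding K_def using J(4) \<rho>s by blast
    ultimately have HU: "H \<union> (U - K) \<subseteq> U" by blast
    define d where "d = Min (insert 1 ((\<lambda>j. \<rho> j / 2) ` J))"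
    have d: "d > 0" using J(1) \<rho>(1) by (auto simp: d_def)
    have d_le: "d \<le> \<rho> j / 2" if "j \<in> J" for j
      unfolding d_def by (rule Min_le) (use J(1) that in auto)
    \<comment> \<open>\<open>H\<close> consists of the half balls, which have positive distance from the complement of \<open>K\<close>\<close>
    have "\<mu> H + \<mu> (U - K) \<le> \<mu> (H \<union> (U - K))"
    proof (rule hausdorff_measure_separated [OF d])
      fix p q assume pq: "p \<in> H" "q \<in> U - K"
      then obtain j where j: "j \<in> J" "dist (x j) p \<le> \<rho> j / 2" by (auto simp: H_def)
      have "\<rho> j < dist (x j) q" using pq(2) j(1) by (auto simp: K_def not_le)
      also have "\<dots> \<le> dist (x j) p + dist p q" by (rule dist_triangle)
      finally show "d \<le> dist p q" using d_le [OF j(1)] j(2) by linarith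
    qed
    also have "\<dots> \<le> ennreal a" using hausdorff_measure_mono [OF HU, of g] a(1) by simp
    finally have add: "\<mu> H + \<mu> (U - K) \<le> ennreal a" .
    have "\<theta> * a = c1 / lam * (\<kappa> * (a / 2) / M)" by (simp add: \<theta>_def field_simps)
    also have "\<dots> \<le> c1 / lam * ((\<Sum>j\<in>J. g (s j)) / M)"
      using J(5) M c1 lam by (intro mult_left_mono divide_right_mono) auto
    also have "\<dots> \<le> c1 / lam * (\<Sum>j\<in>J. g (\<rho> j))"
    proof -
      have "g (s j) / M \<le> g (\<rho> j)" if "j \<in> J" for j
      proof (cases "r j \<le> s j")
        case True
        then show ?thesis using sr [of j] J(2) that M by (auto simp: \<rho>_def field_simps)
      next
        case False
        have "g (s j) \<le> M * g (s j)" using M g_pos [OF s_pos [of j]] by simp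
        then show ?thesis using False M by (simp add: \<rho>_def field_simps)
      qed
      then have "(\<Sum>j\<in>J. g (s j)) / M \<le> (\<Sum>j\<in>J. g (\<rho> j))"
        unfolding sum_divide_distrib by (rule sum_mono)
      then show ?thesis using c1 lam by (intro mult_left_mono) auto
    qed
    finally have "ennreal (\<theta> * a) \<le> ennreal (c1 / lam * (\<Sum>j\<in>J. g (\<rho> j)))" by (rule ennreal_leI)
    also have "\<dots> \<le> \<mu> H"
      unfolding H_def
    proof (rule sum_half_balls_le [OF J(1)])
      show "disjoint_family_on (\<lambda>i. cball (x i) (\<rho> i)) J"
        using J(3) \<rho>s unfolding disjoint_family_on_def by blast
      show "\<rho> i \<le> r0" if "i \<in> J" for i using \<rho>(3) [of i] sG [of i] J(2) that by auto
    qed (use \<rho> in auto)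
    finally have "ennreal (\<theta> * a) + \<mu> (U - K) \<le> ennreal a"
      using add by (meson add_right_mono order_trans)
    moreover have "0 \<le> \<theta> * a" using \<kappa>_pos c1 lam M a(2) by (simp add: \<theta>_def)
    ultimately have "\<mu> (U - K) \<le> ennreal (a - \<theta> * a)"
      by (cases "\<mu> (U - K)") (auto simp: ennreal_plus [symmetric] top_unique a(2) simp del: ennreal_plus
          intro!: ennreal_leI)
    also have "\<dots> \<le> ennreal (max 0 (1 - \<theta>) * b)"
    proof (rule ennreal_leI)
      have "a - \<theta> * a = (1 - \<theta>) * a" by (simp add: algebra_simps)
      also have "\<dots> \<le> max 0 (1 - \<theta>) * b" using a by (intro mult_mono) auto
      finally show "a - \<theta> * a \<le> max 0 (1 - \<theta>) * b" .
    qed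
    finally have "\<mu> (U - K) \<le> ennreal (max 0 (1 - \<theta>) * b)" .
    moreover have "open (U - K)"
      unfolding K_def using J(1) U(1) by (intro open_Diff closed_UN) auto
    moreover have "U - (\<Union>i\<in>{G..}. cball (x i) (r i)) \<subseteq> U - K"
    proof -
      have "K \<subseteq> (\<Union>i\<in>{G..}. cball (x i) (r i))"
        unfolding K_def
      proof (rule UN_mono [OF J(2)])
        show "cball (x i) (\<rho> i) \<subseteq> cball (x i) (r i)" for i
          using \<rho>(2) by (rule subset_cball)
      qed
      then show ?thesis by blast
    qed
    ultimately show thesis unfolding \<theta>_def by (intro that [of "U - K"])
  qed
qed

lemma null_outside_comparable_limsup:
  assumes r: "\<And>i. 0 < r i" and M: "1 \<le> M"
    and sr: "\<And>i. N \<le> i \<Longrightarrow> g (s i) \<le> M * g (r i)"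
  shows "\<mu> (UNIV - limsup (\<lambda>i. cball (x i) (r i))) = 0"
proof -
  define q where "q = max 0 (1 - c1 * \<kappa> / (2 * lam * M))"
  have q: "0 \<le> q" "q < 1" using c1 \<kappa>_pos lam M by (auto simp: q_def)
  define E where "E G = (\<Union>i\<in>{G..}. cball (x i) (r i))" for G
  obtain N' where N': "N' \<ge> N" "\<And>i. N' \<le> i \<Longrightarrow> s i < r0"
    by (rule s_less_from [OF r0, of N]) blast
  have null: "\<mu> (ball d r0 - E G) = 0" if G: "N' \<le> G" for d G
  proof -
    define b where "b = c2 * g r0"
    have b: "0 \<le> b" using c2 g_pos [OF r0] by (simp add: b_def)
    have "\<exists>U. open U \<and> ball d r0 - E G \<subseteq> U \<and> \<mu> U \<le> ennreal (q ^ n * b)" for n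
    proof (induction n)
      case 0
      have "\<mu> (ball d r0) \<le> \<mu> (cball d r0)" by (intro hausdorff_measure_mono ball_subset_cball)
      also have "\<dots> \<le> ennreal b" unfolding b_def using r0 by (intro upper) auto
      finally show ?case by (intro exI [of _ "ball d r0"]) auto
    next
      case (Suc n)
      then obtain U where U: "open U" "ball d r0 - E G \<subseteq> U" "\<mu> U \<le> ennreal (q ^ n * b)" by blast
      obtain U' where U': "open U'" "U - E G \<subseteq> U'" "\<mu> U' \<le> ennreal (q * (q ^ n * b))"
        unfolding E_def q_def
      proof (rule open_shrink_step [OF r M _ _ U(1,3)])
        show "g (s i) \<le> M * g (r i)" if "G \<le> i" for i using sr that G N' by auto
        show "s i \<le> r0" if "G \<le> i" for i using that G N'(2) [of i] by auto
        show "0 \<le> q ^ n * b" using q b by simp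
      qed (auto simp: q_def)
      then show ?case using U(2) by (intro exI [of _ U']) (auto simp: mult.assoc)
    qed
    then have le: "\<mu> (ball d r0 - E G) \<le> ennreal (q ^ n * b)" for n
      by (meson hausdorff_measure_mono order_trans)
    have "(\<lambda>n. ennreal (q ^ n * b)) \<longlonglongrightarrow> ennreal (0 * b)"
      using q by (intro tendsto_ennrealI tendsto_mult LIMSEQ_realpow_zero tendsto_const) auto
    then have "\<mu> (ball d r0 - E G) \<le> 0"
      using le by (intro LIMSEQ_le_const [of "\<lambda>n. ennreal (q ^ n * b)"]) auto
    then show ?thesis by simp
  qed
  have "UNIV - limsup (\<lambda>i. cball (x i) (r i)) \<subseteq> (\<Union>(d, n)\<in>D \<times> UNIV. ball d r0 - E (N' + n))"
  proof
    fix p assume "p \<in> UNIV - limsup (\<lambda>i. cball (x i) (r i))"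
    then obtain n where "\<And>i. n \<le> i \<Longrightarrow> p \<notin> cball (x i) (r i)"
      unfolding limsup_INF_SUP by auto
    then have "p \<notin> E (N' + n)" by (auto simp: E_def)
    moreover obtain d where "d \<in> D" "p \<in> ball d r0"
      using dense_D [OF r0, of p] by (auto simp: dist_commute)
    ultimately show "p \<in> (\<Union>(d, n)\<in>D \<times> UNIV. ball d r0 - E (N' + n))" by blast
  qed
  then have "\<mu> (UNIV - limsup (\<lambda>i. cball (x i) (r i)))
      \<le> \<mu> (\<Union>(d, n)\<in>D \<times> UNIV. ball d r0 - E (N' + n))"
    by (rule hausdorff_measure_mono)
  also have "\<dots> = 0"
    by (rule hausdorff_measure_UN_null) (use countable_D null in auto)
  finally show ?thesis by simp
qed

end

section \<open>Layers of balls inside a ball\<close>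

text \<open>The case in which \<open>f / g\<close> is nonincreasing and tends to \<open>\<infinity>\<close> at \<open>0\<close>. Both conditions are stated
  without division.\<close>

locale steep_transference = full_limsup g lam c1 c2 r0 D x s
  for g lam c1 c2 r0 and D :: "'a::metric_space set" and x s +
  fixes f :: "real \<Rightarrow> real" and r :: "nat \<Rightarrow> real"
  assumes r_pos: "0 < r i" and r_lim: "r \<longlonglongrightarrow> 0"
    and f_pos: "0 < t \<Longrightarrow> 0 < f t"
    and f_mono: "0 < t \<Longrightarrow> t \<le> u \<Longrightarrow> f t \<le> f u"
    and f_cont: "continuous_on {0<..} f"
    and g_s: "g (s i) = f (r i)"
    and ratio: "0 < t \<Longrightarrow> t \<le> u \<Longrightarrow> f u * g t \<le> f t * g u"
    and steep: "\<exists>t0>0. \<forall>t. 0 < t \<longrightarrow> t \<le> t0 \<longrightarrow> M * g t \<le> f t"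
begin

lemma r_less_from:
  assumes "e > 0" obtains N where "N \<ge> G" "\<And>i. i \<ge> N \<Longrightarrow> r i < e"
proof -
  have "\<forall>\<^sub>F i in sequentially. r i < e"
    using order_tendstoD(2) [OF r_lim assms] .
  then obtain N where "\<And>i. i \<ge> N \<Longrightarrow> r i < e" unfolding eventually_sequentially by blast
  then show thesis by (intro that [of "max N G"]) auto
qed

lemma g_r_small_from:
  obtains N where "N \<ge> G" "\<And>i. i \<ge> N \<Longrightarrow> M * g (r i) \<le> g (s i)"
proof -
  obtain t0 where t0: "t0 > 0" "\<And>t. 0 < t \<Longrightarrow> t \<le> t0 \<Longrightarrow> M * g t \<le> f t" using steep by blast
  obtain N where "N \<ge> G" "\<And>i. i \<ge> N \<Longrightarrow> r i < t0" by (rule r_less_from [OF t0(1), of G]) blast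
  then show thesis using t0(2) r_pos g_s by (intro that [of N]) (auto simp: less_imp_le)
qed

text \<open>If \<open>r i\<close> exceeded \<open>s i / 2\<close>, then doubling would bound \<open>g (s i)\<close> by \<open>lam * g (r i)\<close>.\<close>

lemma r_le_half_s_from:
  obtains N where "N \<ge> G" "\<And>i. i \<ge> N \<Longrightarrow> r i \<le> s i / 2"
proof -
  obtain N where N: "N \<ge> G" "\<And>i. i \<ge> N \<Longrightarrow> (2 * lam) * g (r i) \<le> g (s i)"
    by (rule g_r_small_from [of G "2 * lam"]) blast
  have "r i \<le> s i / 2" if "i \<ge> N" for i
  proof (rule ccontr)
    assume "\<not> r i \<le> s i / 2"
    then have "g (s i / 2) \<le> g (r i)" using s_pos [of i] by (intro g_mono) auto
    then have "lam * g (s i / 2) \<le> lam * g (r i)" using lam by simp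
    moreover have "g (s i) \<le> lam * g (s i / 2)" by (rule g_half [OF s_pos])
    moreover have "0 < lam * g (r i)" using lam g_pos r_pos by simp
    ultimately show False using N(2) [OF that] by linarith
  qed
  then show thesis using N(1) by (intro that) auto
qed

text \<open>The indices in \<open>S\<close> of the original balls that meet the ball with centre \<open>a\<close> and radius \<open>\<rho>\<close>.\<close>

definition hits :: "'a \<Rightarrow> real \<Rightarrow> nat set \<Rightarrow> nat set" where
  "hits a \<rho> S = {i\<in>S. cball (x i) (r i) \<inter> cball a \<rho> \<noteq> {}}"

lemma hits_subset: "hits a \<rho> S \<subseteq> S" by (auto simp: hits_def)

lemma hits_Un: "hits a \<rho> (S \<union> T) = hits a \<rho> S \<union> hits a \<rho> T" by (auto simp: hits_def)

lemma finite_hits: "finite S \<Longrightarrow> finite (hits a \<rho> S)" by (simp add: hits_def)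

text \<open>The constant of the lemma \<open>packing\<close> for a ball of eightfold radius, made at least \<open>1\<close>.\<close>

definition pack_const :: real where "pack_const = max 1 (lam * c2 / c1 * lam ^ 3)"

lemma pack_const_ge_1: "1 \<le> pack_const" by (simp add: pack_const_def)

lemma sum_hits_le_packing:
  assumes J: "finite J" "disjoint_family_on (\<lambda>i. cball (x i) (s i)) J"
    and rs: "\<And>j. j \<in> J \<Longrightarrow> r j \<le> s j / 2"
    and \<rho>: "0 < \<rho>" "8 * \<rho> \<le> r0" and small: "\<And>j. j \<in> hits a \<rho> J \<Longrightarrow> s j \<le> 4 * \<rho>"
  shows "(\<Sum>j\<in>hits a \<rho> J. g (s j)) \<le> pack_const * g \<rho>"
proof -
  have "(\<Sum>j\<in>hits a \<rho> J. g (s j)) \<le> lam * c2 / c1 * g (8 * \<rho>)"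
  proof (rule packing)
    show "finite (hits a \<rho> J)" using J(1) by (rule finite_hits)
    show "disjoint_family_on (\<lambda>i. cball (x i) (s i)) (hits a \<rho> J)"
      using hits_subset J(2) by (rule disjoint_family_on_mono)
    fix j assume j: "j \<in> hits a \<rho> J"
    show "0 < s j" by (rule s_pos)
    show "s j \<le> r0" using small [OF j] \<rho> by linarith
    obtain p where p: "dist (x j) p \<le> r j" "dist a p \<le> \<rho>" using j by (auto simp: hits_def)
    have "dist a q \<le> 8 * \<rho>" if "dist (x j) q \<le> s j" for q
    proof -
      have "dist a q \<le> dist a p + dist (x j) p + dist (x j) q"
        by (metis dist_commute dist_triangle dist_triangle_le add.assoc add_left_mono)
      moreover have "r j \<le> s j / 2" using j rs hits_subset by blast
      ultimately show ?thesis using p that small [OF j] \<rho> by linarith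
    qed
    then show "cball (x j) (s j) \<subseteq> cball a (8 * \<rho>)" by auto
  qed (use \<rho> in auto)
  also have "\<dots> \<le> lam * c2 / c1 * (lam ^ 3 * g \<rho>)"
    using g_le_8 [of \<rho> "8 * \<rho>"] \<rho> lam c1 c2 by (intro mult_left_mono) auto
  also have "\<dots> \<le> pack_const * g \<rho>"
    using g_pos [OF \<rho>(1)] unfolding pack_const_def mult.assoc [symmetric] by (intro mult_right_mono) auto
  finally show ?thesis .
qed

text \<open>A ball that meets two of the original balls leaves one of the disjoint enlarged balls after
  having met its middle half, so its diameter is not small compared with \<open>s i\<close>.\<close>

lemma two_hits_small:
  assumes J: "disjoint_family_on (\<lambda>i. cball (x i) (s i)) J" "\<And>j. j \<in> J \<Longrightarrow> r j \<le> s j / 2"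
    and ij: "i \<in> hits a \<rho> J" "j \<in> hits a \<rho> J" "i \<noteq> j"
  shows "s i \<le> 4 * \<rho>"
proof -
  obtain p where p: "dist (x i) p \<le> r i" "dist a p \<le> \<rho>" using ij(1) by (auto simp: hits_def)
  obtain q where q: "dist (x j) q \<le> r j" "dist a q \<le> \<rho>" using ij(2) by (auto simp: hits_def)
  have J': "i \<in> J" "j \<in> J" using ij hits_subset by blast+
  have "q \<in> cball (x j) (s j)" using q(1) J(2) [OF J'(2)] s_pos [of j] by auto
  then have "s i < dist (x i) q"
    using J(1) J' ij(3) unfolding disjoint_family_on_def by (metis IntI empty_iff mem_cball not_le)
  also have "\<dots> \<le> dist (x i) p + (dist a p + dist a q)"
    by (metis add_left_mono dist_commute dist_triangle dist_triangle2 order_trans)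
  finally show ?thesis using p q J(2) [OF J'(1)] by linarith
qed

text \<open>The \<open>g\<close>-sum that one selection of disjoint balls contributes in a ball of radius \<open>t\<close>, relative
  to \<open>g t\<close>. The selection takes place in an open set of measure more than
  \<open>c1 / (4 * lam) * g t\<close>.\<close>

definition \<tau> :: real where "\<tau> = \<kappa> * c1 / (4 * lam)"

lemma \<tau>_pos: "0 < \<tau>" using \<kappa>_pos c1 lam by (simp add: \<tau>_def)

text \<open>A finite family \<open>I\<close> of disjoint original balls inside \<open>ball z t\<close>, as produced by \<open>l\<close> successive
  selections: the sum of \<open>g (s i)\<close> grows linearly with \<open>l\<close> while the sum of \<open>g (r i)\<close>, which controls the
  space taken up, stays below \<open>\<delta>\<close>. The last condition bounds the sum over the balls met by
  a ball of radius \<open>\<rho>\<close>: every layer contributes at most a constant times \<open>g \<rho>\<close>, except for a single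
  ball, which may contribute \<open>f \<rho>\<close>. Nothing is claimed if at most one ball is met.\<close>

definition layered :: "nat \<Rightarrow> real \<Rightarrow> nat \<Rightarrow> 'a \<Rightarrow> real \<Rightarrow> nat set \<Rightarrow> bool" where
  "layered l \<delta> G z t I \<longleftrightarrow> finite I \<and> I \<subseteq> {G..} \<and> (\<forall>i\<in>I. cball (x i) (r i) \<subseteq> ball z t) \<and>
    disjoint_family_on (\<lambda>i. cball (x i) (r i)) I \<and>
    real l * \<tau> * g t \<le> (\<Sum>i\<in>I. g (s i)) \<and> (\<Sum>i\<in>I. g (r i)) \<le> \<delta> \<and>
    (\<forall>a \<rho>. 0 < \<rho> \<longrightarrow> 8 * \<rho> \<le> r0 \<longrightarrow>
      (\<exists>k. hits a \<rho> I \<subseteq> {k}) \<or> (\<Sum>i\<in>hits a \<rho> I. g (s i)) \<le> pack_const * (real l * g \<rho> + f \<rho>))"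

lemma layeredD:
  assumes "layered l \<delta> G z t I"
  shows "finite I" "I \<subseteq> {G..}" "\<And>i. i \<in> I \<Longrightarrow> cball (x i) (r i) \<subseteq> ball z t"
    "disjoint_family_on (\<lambda>i. cball (x i) (r i)) I"
    "real l * \<tau> * g t \<le> (\<Sum>i\<in>I. g (s i))" "(\<Sum>i\<in>I. g (r i)) \<le> \<delta>"
    "\<And>a \<rho>. 0 < \<rho> \<Longrightarrow> 8 * \<rho> \<le> r0 \<Longrightarrow>
      (\<exists>k. hits a \<rho> I \<subseteq> {k}) \<or> (\<Sum>i\<in>hits a \<rho> I. g (s i)) \<le> pack_const * (real l * g \<rho> + f \<rho>)"
  using assms by (simp_all only: layered_def)

text \<open>Induction on the number of layers. The next layer \<open>J\<close> is selected in the set \<open>V\<close> left over by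
  the balls of threefold radius of the earlier layers \<open>I\<close>, with enlarged radii \<open>s j\<close> below all
  earlier radii \<open>r i\<close>. A ball of radius \<open>\<rho>\<close> that meets both \<open>I\<close> and \<open>J\<close> crosses the gap
  around a ball of \<open>I\<close>, so \<open>\<rho>\<close> exceeds the radius of that ball and hence all \<open>s j\<close>, and the packing bound
  applies to \<open>J\<close>.\<close>

lemma layered_exists:
  assumes t: "0 < t" "t \<le> r0" and \<delta>: "0 < \<delta>"
  shows "\<exists>I. layered l \<delta> G z t I"
  using \<delta>
proof (induction l arbitrary: \<delta> G)
  case 0
  show ?case
    using 0 by (intro exI [of _ "{}"]) (auto simp: layered_def hits_def disjoint_family_on_def)
next
  case (Suc l)
  have gt: "0 < g t" by (rule g_pos [OF t(1)])
  define \<delta>' where "\<delta>' = min (\<delta> / 2) (c1 / (2 * lam * (c2 * lam ^ 3)) * g t)"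
  have \<delta>': "0 < \<delta>'" "\<delta>' \<le> \<delta> / 2" "c2 * lam ^ 3 * \<delta>' \<le> c1 / (2 * lam) * g t"
  proof -
    show "0 < \<delta>'" "\<delta>' \<le> \<delta> / 2" using Suc.prems gt c1 c2 lam by (auto simp: \<delta>'_def)
    have "c2 * lam ^ 3 * \<delta>' \<le> c2 * lam ^ 3 * (c1 / (2 * lam * (c2 * lam ^ 3)) * g t)"
      using c2 lam by (intro mult_left_mono) (auto simp: \<delta>'_def)
    also have "\<dots> = c1 / (2 * lam) * g t" using c2 lam by simp
    finally show "c2 * lam ^ 3 * \<delta>' \<le> c1 / (2 * lam) * g t" .
  qed
  obtain N1 where N1: "N1 \<ge> G" "\<And>i. i \<ge> N1 \<Longrightarrow> r i < r0 / 3"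
    by (rule r_less_from [of "r0 / 3" G]) (use r0 in auto)
  obtain I where "layered l \<delta>' N1 z t I"
    using Suc.IH [OF \<delta>'(1), of N1] by blast
  note I = layeredD [OF this]
  define V where "V = ball z t - (\<Union>i\<in>I. cball (x i) (3 * r i))"
  have "open V" unfolding V_def using I(1) by (intro open_Diff closed_UN) auto
  have V: "ennreal (c1 / (4 * lam) * g t) < \<mu> V"
  proof (rule ccontr)
    assume "\<not> ?thesis"
    then have small: "\<mu> V \<le> ennreal (c1 / (4 * lam) * g t)" by simp
    have "ennreal (c1 * g (t / 2)) \<le> \<mu> (cball z (t / 2))" using t by (intro lower) auto
    also have "\<dots> \<le> \<mu> (V \<union> (\<Union>i\<in>I. cball (x i) (3 * r i)))"
      using t by (intro hausdorff_measure_mono) (auto simp: V_def)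
    also have "\<dots> \<le> \<mu> V + \<mu> (\<Union>i\<in>I. cball (x i) (3 * r i))" by (rule hausdorff_measure_Un_le)
    also have "\<dots> \<le> \<mu> V + (\<Sum>i\<in>I. \<mu> (cball (x i) (3 * r i)))"
      using I(1) by (intro add_left_mono hausdorff_measure_UN_finite_le)
    also have "\<dots> \<le> \<mu> V + (\<Sum>i\<in>I. ennreal (c2 * lam ^ 3 * g (r i)))"
    proof (intro add_left_mono sum_mono)
      fix i assume "i \<in> I"
      then have "\<mu> (cball (x i) (3 * r i)) \<le> ennreal (c2 * g (3 * r i))"
        using I(2) N1(2) [of i] r_pos [of i] by (intro upper) auto
      also have "\<dots> \<le> ennreal (c2 * lam ^ 3 * g (r i))"
        using g_le_8 [of "r i" "3 * r i"] r_pos [of i] c2 by (intro ennreal_leI) auto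
      finally show "\<mu> (cball (x i) (3 * r i)) \<le> \<dots>" .
    qed
    also have "(\<Sum>i\<in>I. ennreal (c2 * lam ^ 3 * g (r i))) = ennreal (c2 * lam ^ 3 * (\<Sum>i\<in>I. g (r i)))"
      unfolding sum_distrib_left using c2 lam g_pos [OF r_pos]
      by (intro sum_ennreal) (auto simp: less_imp_le)
    also have "\<dots> \<le> ennreal (c2 * lam ^ 3 * \<delta>')"
      using I(6) c2 lam by (intro ennreal_leI mult_left_mono) auto
    also have "\<dots> \<le> ennreal (c1 / (2 * lam) * g t)" using \<delta>'(3) by (rule ennreal_leI)
    finally have "ennreal (c1 * g (t / 2)) \<le> \<mu> V + ennreal (c1 / (2 * lam) * g t)"
      by (simp add: add_left_mono)
    also have "\<dots> \<le> ennreal (c1 / (4 * lam) * g t) + ennreal (c1 / (2 * lam) * g t)"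
      using small by (rule add_right_mono)
    also have "\<dots> = ennreal (3 * c1 / (4 * lam) * g t)"
      using c1 lam gt by (subst ennreal_plus [symmetric]) (auto simp: field_simps)
    finally have "c1 * g (t / 2) \<le> 3 * c1 / (4 * lam) * g t"
      using c1 lam gt by (subst (asm) ennreal_le_iff) auto
    then have "lam * g (t / 2) \<le> 3 / 4 * g t" using c1 lam by (simp add: field_simps)
    then show False using g_half [OF t(1)] gt by linarith
  qed
  obtain N2 where N2: "N2 \<ge> G" "\<And>i. i \<ge> N2 \<Longrightarrow> r i \<le> s i / 2"
    by (rule r_le_half_s_from [of G]) blast
  define e where "e = Min (insert r0 (r ` I))"
  have e: "0 < e" using I(1) r0 r_pos by (auto simp: e_def)
  have e_le: "e \<le> r0" "\<And>i. i \<in> I \<Longrightarrow> e \<le> r i"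
    unfolding e_def using I(1) by (auto intro: Min_le)
  obtain N3 where N3: "N3 \<ge> N2" "\<And>i. i \<ge> N3 \<Longrightarrow> s i < e"
    by (rule s_less_from [OF e, of N2]) blast
  \<comment> \<open>the factor by which \<open>g (s j)\<close> has to exceed \<open>g (r j)\<close> for the new layer to use up at most \<open>\<delta> / 2\<close>\<close>
  define M where "M = 2 * (lam * c2 / c1 * g t) / \<delta>"
  have M: "0 < M" using lam c1 c2 gt Suc.prems by (simp add: M_def)
  obtain N4 where N4: "N4 \<ge> N3" "\<And>i. i \<ge> N4 \<Longrightarrow> M * g (r i) \<le> g (s i)"
    by (rule g_r_small_from [of N3 M]) blast
  have nn: "0 \<le> c1 / (4 * lam) * g t" using c1 lam gt by simp
  obtain J where J: "finite J" "J \<subseteq> {N4..}" "disjoint_family_on (\<lambda>i. cball (x i) (s i)) J"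
    "\<And>j. j \<in> J \<Longrightarrow> cball (x j) (s j) \<subseteq> V"
    "\<kappa> * (c1 / (4 * lam) * g t) < (\<Sum>j\<in>J. g (s j))"
    by (rule open_contains_disjoint_balls [OF \<open>open V\<close> nn V, of N4]) blast
  have Jfacts: "r j \<le> s j / 2" "s j < e" "M * g (r j) \<le> g (s j)" "G \<le> j" if "j \<in> J" for j
  proof -
    have "N4 \<le> j" using J(2) that by auto
    then show "r j \<le> s j / 2" "s j < e" "M * g (r j) \<le> g (s j)" "G \<le> j"
      using N2 N3 N4 by (meson order_trans)+
  qed
  have rV: "cball (x j) (r j) \<subseteq> V" if "j \<in> J" for j
  proof -
    have "r j \<le> s j" using Jfacts(1) [OF that] s_pos [of j] by linarith
    then show ?thesis using J(4) [OF that] subset_cball by blast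
  qed
  have IJ_dis: "cball (x i) (r i) \<inter> cball (x j) (r j) = {}" if "i \<in> I" "j \<in> J" for i j
  proof -
    have "cball (x i) (r i) \<subseteq> cball (x i) (3 * r i)" using r_pos [of i] by (intro subset_cball) auto
    then show ?thesis using rV [OF that(2)] that(1) unfolding V_def by blast
  qed
  have IJ: "I \<inter> J = {}"
  proof (rule ccontr)
    assume "I \<inter> J \<noteq> {}"
    then obtain i where "i \<in> I" "i \<in> J" by blast
    then have "cball (x i) (r i) = {}" using IJ_dis [of i i] by simp
    then show False using r_pos [of i] by (simp add: not_less_iff_gr_or_eq)
  qed
  have sumJ: "(\<Sum>j\<in>J. g (s j)) \<le> lam * c2 / c1 * g t"
  proof (rule packing [OF J(1,3) _ _ _ t])
    fix j assume j: "j \<in> J"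
    show "0 < s j" by (rule s_pos)
    show "s j \<le> r0" using Jfacts(2) [OF j] e_le(1) by linarith
    have "V \<subseteq> cball z t" unfolding V_def by auto
    then show "cball (x j) (s j) \<subseteq> cball z t" using J(4) [OF j] by blast
  qed
  show ?case
    unfolding layered_def
  proof (intro exI [of _ "I \<union> J"] conjI ballI allI impI)
    show "finite (I \<union> J)" using I(1) J(1) by simp
    show "I \<union> J \<subseteq> {G..}" using I(2) N1(1) Jfacts(4) by auto
    show "cball (x i) (r i) \<subseteq> ball z t" if "i \<in> I \<union> J" for i
      using that I(3) rV unfolding V_def by blast
    show "disjoint_family_on (\<lambda>i. cball (x i) (r i)) (I \<union> J)"
      unfolding disjoint_family_on_def
    proof (intro ballI impI)
      fix i j assume ij: "i \<in> I \<union> J" "j \<in> I \<union> J" "i \<noteq> j"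
      have "cball (x i) (r i) \<inter> cball (x j) (r j) = {}" if "i \<in> J" "j \<in> J"
      proof -
        have "cball (x k) (r k) \<subseteq> cball (x k) (s k)" if "k \<in> J" for k
          using Jfacts(1) [OF that] s_pos [of k] by (intro subset_cball) auto
        then show ?thesis using J(3) that ij(3) unfolding disjoint_family_on_def by blast
      qed
      moreover have "cball (x i) (r i) \<inter> cball (x j) (r j) = {}" if "i \<in> I" "j \<in> I"
        using I(4) that ij(3) unfolding disjoint_family_on_def by blast
      ultimately show "cball (x i) (r i) \<inter> cball (x j) (r j) = {}"
        using ij(1,2) IJ_dis [of i j] IJ_dis [of j i] by blast
    qed
    show "real (Suc l) * \<tau> * g t \<le> (\<Sum>i\<in>I \<union> J. g (s i))"
    proof -
      have "real (Suc l) * \<tau> * g t = real l * \<tau> * g t + \<kappa> * (c1 / (4 * lam) * g t)"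
        by (simp add: \<tau>_def algebra_simps add_divide_distrib)
      then show ?thesis using I(1,5) J(1,5) IJ by (simp add: sum.union_disjoint)
    qed
    show "(\<Sum>i\<in>I \<union> J. g (r i)) \<le> \<delta>"
    proof -
      have "M * (\<Sum>j\<in>J. g (r j)) \<le> (\<Sum>j\<in>J. g (s j))"
        unfolding sum_distrib_left using Jfacts(3) by (intro sum_mono)
      also have "\<dots> \<le> M * (\<delta> / 2)" using sumJ Suc.prems by (simp add: M_def)
      finally have "(\<Sum>j\<in>J. g (r j)) \<le> \<delta> / 2" using M by simp
      then show ?thesis using I(1,6) J(1) IJ \<delta>'(2) by (simp add: sum.union_disjoint)
    qed
    fix a \<rho> assume \<rho>: "0 < \<rho>" "8 * \<rho> \<le> r0"
    have pos: "0 < g \<rho>" "0 < f \<rho>" using g_pos f_pos \<rho>(1) by auto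
    show "(\<exists>k. hits a \<rho> (I \<union> J) \<subseteq> {k}) \<or>
      (\<Sum>i\<in>hits a \<rho> (I \<union> J). g (s i)) \<le> pack_const * (real (Suc l) * g \<rho> + f \<rho>)"
    proof -
      have bound: "pack_const * (real (Suc l) * g \<rho> + f \<rho>) = pack_const * (real l * g \<rho> + f \<rho>) + pack_const * g \<rho>"
        by (simp add: algebra_simps)
      have nonneg: "0 \<le> pack_const * g \<rho>" "0 \<le> pack_const * (real l * g \<rho> + f \<rho>)" using pack_const_ge_1 pos by auto
      consider "hits a \<rho> J = {}" | "hits a \<rho> I = {}" "hits a \<rho> J \<noteq> {}"
        | i j where "i \<in> hits a \<rho> I" "j \<in> hits a \<rho> J" by blast
      then show ?thesis
      proof cases
        case 1
        then show ?thesis using I(7) [OF \<rho>, of a] nonneg(1) unfolding hits_Un bound by auto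
      next
        case 2
        show ?thesis
        proof (cases "\<exists>k. hits a \<rho> J \<subseteq> {k}")
          case True
          then show ?thesis using 2 unfolding hits_Un by auto
        next
          case False
          have "(\<Sum>j\<in>hits a \<rho> J. g (s j)) \<le> pack_const * g \<rho>"
          proof (rule sum_hits_le_packing [OF J(1,3) Jfacts(1) \<rho>])
            fix j assume j: "j \<in> hits a \<rho> J"
            then obtain k where "k \<in> hits a \<rho> J" "k \<noteq> j" using False by blast
            then show "s j \<le> 4 * \<rho>" using j by (intro two_hits_small [OF J(3) Jfacts(1)]) auto
          qed
          then show ?thesis using 2 nonneg unfolding hits_Un bound by auto
        qed
      next
        case 3
        have "r i < \<rho>" if i: "i \<in> hits a \<rho> I" for i
        proof -
          obtain p where p: "dist (x i) p \<le> r i" "dist a p \<le> \<rho>" using i by (auto simp: hits_def)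
          obtain q where q: "q \<in> cball (x j) (r j)" "dist a q \<le> \<rho>" using 3(2) by (auto simp: hits_def)
          have "q \<in> V" using q(1) rV [of j] 3(2) by (auto simp: hits_def)
          then have "3 * r i < dist (x i) q" using i by (auto simp: V_def hits_def not_le)
          also have "\<dots> \<le> dist (x i) p + (dist a p + dist a q)"
            by (metis add_left_mono dist_commute dist_triangle dist_triangle2 order_trans)
          finally show ?thesis using p q by linarith
        qed
        then have r\<rho>: "r i < \<rho>" using 3(1) by blast
        have "(\<Sum>j\<in>hits a \<rho> J. g (s j)) \<le> pack_const * g \<rho>"
        proof (rule sum_hits_le_packing [OF J(1,3) Jfacts(1) \<rho>])
          fix k assume "k \<in> hits a \<rho> J"
          then have "s k < e" using Jfacts(2) by (auto simp: hits_def)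
          moreover have "e \<le> r i" using 3(1) by (intro e_le) (auto simp: hits_def)
          ultimately show "s k \<le> 4 * \<rho>" using r\<rho> \<rho>(1) by linarith
        qed
        moreover have "(\<Sum>i\<in>hits a \<rho> I. g (s i)) \<le> pack_const * (real l * g \<rho> + f \<rho>)"
        proof (cases "\<exists>k. hits a \<rho> I \<subseteq> {k}")
          case True
          then have "hits a \<rho> I = {i}" using 3(1) by blast
          then have "(\<Sum>i\<in>hits a \<rho> I. g (s i)) = f (r i)" by (simp add: g_s)
          also have "\<dots> \<le> f \<rho>" using r\<rho> r_pos by (intro f_mono) auto
          also have "\<dots> \<le> 1 * (real l * g \<rho> + f \<rho>)" using pos by simp
          also have "\<dots> \<le> pack_const * (real l * g \<rho> + f \<rho>)"
            using pack_const_ge_1 pos by (intro mult_right_mono) auto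
          finally show ?thesis .
        next
          case False
          then show ?thesis using I(7) [OF \<rho>, of a] by blast
        qed
        moreover have "(\<Sum>i\<in>hits a \<rho> (I \<union> J). g (s i))
            = (\<Sum>i\<in>hits a \<rho> I. g (s i)) + (\<Sum>j\<in>hits a \<rho> J. g (s j))"
          unfolding hits_Un
        proof (intro sum.union_disjoint finite_hits I(1) J(1))
          show "hits a \<rho> I \<inter> hits a \<rho> J = {}"
            using IJ hits_subset [of a \<rho> I] hits_subset [of a \<rho> J] by blast
        qed
        ultimately show ?thesis unfolding bound by linarith
      qed
    qed
  qed
qed

section \<open>Redistribution of mass\<close>

text \<open>The constant in the mass estimates, dominating both \<open>pack_const / \<tau>\<close> and \<open>pack_const\<close>.\<close>

definition mass_const :: real where "mass_const = pack_const * (1 + 1 / \<tau>)"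

lemma mass_const_ge_1: "1 \<le> mass_const"
proof -
  have "1 * 1 \<le> pack_const * (1 + 1 / \<tau>)" using pack_const_ge_1 \<tau>_pos by (intro mult_mono) auto
  then show ?thesis by (simp add: mass_const_def)
qed

text \<open>A distribution \<open>w\<close> of the mass \<open>m\<close> over finitely many disjoint original balls inside
  \<open>ball z t\<close> with indices at least \<open>G\<close>, with shares at most \<open>f (r i) / \<eta>\<close>.
  A ball of radius \<open>\<rho>\<close> that meets several of them meets at most the
  share \<open>m * g \<rho> / g t\<close> of a uniform distribution or the mass \<open>f \<rho> / \<eta>\<close>, up to
  a constant.\<close>

definition mass_family ::
    "real \<Rightarrow> real \<Rightarrow> nat \<Rightarrow> 'a \<Rightarrow> real \<Rightarrow> nat set \<Rightarrow> (nat \<Rightarrow> real) \<Rightarrow> bool" where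
  "mass_family m \<eta> G z t S w \<longleftrightarrow> finite S \<and> S \<subseteq> {G..} \<and>
    (\<forall>i\<in>S. cball (x i) (r i) \<subseteq> ball z t) \<and> disjoint_family_on (\<lambda>i. cball (x i) (r i)) S \<and>
    (\<forall>i\<in>S. 0 < w i \<and> w i \<le> f (r i) / \<eta>) \<and> sum w S = m \<and>
    (\<forall>a \<rho>. 0 < \<rho> \<longrightarrow> 8 * \<rho> \<le> r0 \<longrightarrow>
      (\<exists>k. hits a \<rho> S \<subseteq> {k}) \<or> sum w (hits a \<rho> S) \<le> mass_const * (m * g \<rho> / g t + f \<rho> / \<eta>))"

lemma mass_familyD:
  assumes "mass_family m \<eta> G z t S w"
  shows "finite S" "S \<subseteq> {G..}" "\<And>i. i \<in> S \<Longrightarrow> cball (x i) (r i) \<subseteq> ball z t"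
    "disjoint_family_on (\<lambda>i. cball (x i) (r i)) S"
    "\<And>i. i \<in> S \<Longrightarrow> 0 < w i" "\<And>i. i \<in> S \<Longrightarrow> w i \<le> f (r i) / \<eta>" "sum w S = m"
    "\<And>a \<rho>. 0 < \<rho> \<Longrightarrow> 8 * \<rho> \<le> r0 \<Longrightarrow>
      (\<exists>k. hits a \<rho> S \<subseteq> {k}) \<or> sum w (hits a \<rho> S) \<le> mass_const * (m * g \<rho> / g t + f \<rho> / \<eta>)"
  using assms by (simp_all only: mass_family_def)

text \<open>The mass is distributed over a layered family in proportion to \<open>g (s i) = f (r i)\<close>; enough
  layers make each share at most \<open>f (r i) / \<eta>\<close>.\<close>

lemma mass_family_exists:
  assumes t: "0 < t" "t \<le> r0" and m: "0 < m" and \<eta>: "0 < \<eta>"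
  obtains S w where "mass_family m \<eta> G z t S w"
proof -
  have gt: "0 < g t" by (rule g_pos [OF t(1)])
  obtain l :: nat where l: "m * \<eta> / (\<tau> * g t) < real l" using reals_Archimedean2 by blast
  have "0 < m * \<eta> / (\<tau> * g t)" using m \<eta> \<tau>_pos gt by simp
  then have l_pos: "0 < real l" using l by linarith
  have l': "m * \<eta> \<le> real l * \<tau> * g t" using l \<tau>_pos gt by (simp add: field_simps)
  obtain I where "layered l 1 G z t I"
    using layered_exists [OF t zero_less_one, of l G z] by blast
  note I = layeredD [OF this]
  define T where "T = (\<Sum>i\<in>I. g (s i))"
  have T: "m * \<eta> \<le> T" "real l * \<tau> * g t \<le> T" using l' I(5) by (auto simp: T_def)
  have T_pos: "0 < T" using T(1) m \<eta> by (meson less_le_trans mult_pos_pos)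
  have mT: "m / T \<le> 1 / \<eta>" using T(1) T_pos \<eta> by (simp add: field_simps)
  define w where "w i = m / T * g (s i)" for i
  have sum_w: "sum w A = m / T * (\<Sum>i\<in>A. g (s i))" for A
    by (simp add: w_def sum_distrib_left)
  have "mass_family m \<eta> G z t I w"
    unfolding mass_family_def
  proof (intro conjI ballI allI impI)
    show "0 < w i" for i using m T_pos g_pos [OF s_pos [of i]] by (simp add: w_def)
    show "w i \<le> f (r i) / \<eta>" for i
    proof -
      have "m / T * g (s i) \<le> 1 / \<eta> * g (s i)"
        using mT g_pos [OF s_pos [of i]] by (intro mult_right_mono) auto
      then show ?thesis by (simp add: w_def g_s)
    qed
    show "sum w I = m" using T_pos unfolding sum_w by (simp add: T_def)
    fix a \<rho> assume \<rho>: "0 < \<rho>" "8 * \<rho> \<le> r0"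
    have pos: "0 < g \<rho>" "0 < f \<rho>" using g_pos f_pos \<rho>(1) by auto
    show "(\<exists>k. hits a \<rho> I \<subseteq> {k}) \<or> sum w (hits a \<rho> I) \<le> mass_const * (m * g \<rho> / g t + f \<rho> / \<eta>)"
    proof (cases "\<exists>k. hits a \<rho> I \<subseteq> {k}")
      case False
      have "m / T * real l \<le> m / (real l * \<tau> * g t) * real l"
        using T m l_pos \<tau>_pos gt T_pos by (intro mult_right_mono divide_left_mono) auto
      also have "\<dots> = m / (\<tau> * g t)" using l_pos by simp
      finally have ml: "m / T * real l \<le> m / (\<tau> * g t)" .
      have "sum w (hits a \<rho> I) \<le> m / T * (pack_const * (real l * g \<rho> + f \<rho>))"
        unfolding sum_w using False I(7) [OF \<rho>, of a] m T_pos by (intro mult_left_mono) auto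
      also have "\<dots> = pack_const * (m / T * real l * g \<rho> + m / T * f \<rho>)" by (simp add: algebra_simps)
      also have "\<dots> \<le> pack_const * (m / (\<tau> * g t) * g \<rho> + 1 / \<eta> * f \<rho>)"
        using ml mT pos pack_const_ge_1 by (intro mult_left_mono add_mono mult_right_mono) auto
      also have "\<dots> = pack_const * (1 / \<tau> * (m * g \<rho> / g t) + 1 * (f \<rho> / \<eta>))" by simp
      also have "\<dots> \<le> pack_const * ((1 + 1 / \<tau>) * (m * g \<rho> / g t) + (1 + 1 / \<tau>) * (f \<rho> / \<eta>))"
        using pack_const_ge_1 pos \<tau>_pos m gt \<eta> by (intro mult_left_mono add_mono mult_right_mono) auto
      also have "\<dots> = mass_const * (m * g \<rho> / g t + f \<rho> / \<eta>)" by (simp add: mass_const_def algebra_simps)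
      finally show ?thesis by blast
    qed blast
  qed (use I in auto)
  then show thesis by (rule that)
qed

section \<open>The Cantor construction\<close>

text \<open>Level \<open>n\<close> of the Cantor construction in \<open>cball z t\<close>: a probability distribution \<open>w\<close> on finitely many disjoint
  original balls with indices at least \<open>n\<close>. The mass of a ball is bounded in terms of
  its radius, and so is the total mass of the balls met by a ball of radius
  \<open>\<rho> \<le> \<rho>0\<close>, unless at most one ball is met.\<close>

definition mass_level ::
    "'a \<Rightarrow> real \<Rightarrow> real \<Rightarrow> real \<Rightarrow> nat \<Rightarrow> nat set \<Rightarrow> (nat \<Rightarrow> real) \<Rightarrow> bool" where
  "mass_level z t \<eta> \<rho>0 n S w \<longleftrightarrow> finite S \<and> S \<subseteq> {n..} \<and>
    (\<forall>i\<in>S. cball (x i) (r i) \<subseteq> cball z t) \<and> (\<forall>i\<in>S. r i \<le> r0) \<and>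
    disjoint_family_on (\<lambda>i. cball (x i) (r i)) S \<and>
    (\<forall>i\<in>S. 0 < w i) \<and> (\<forall>i\<in>S. w i \<le> f (r i) / \<eta>) \<and> sum w S = 1 \<and>
    (\<forall>a \<rho>. 0 < \<rho> \<longrightarrow> \<rho> \<le> \<rho>0 \<longrightarrow>
      (\<exists>k. hits a \<rho> S \<subseteq> {k}) \<or> sum w (hits a \<rho> S) \<le> 2 * mass_const * (f \<rho> / \<eta>))"

lemma mass_levelD:
  assumes "mass_level z t \<eta> \<rho>0 n S w"
  shows "finite S" "S \<subseteq> {n..}" "\<And>i. i \<in> S \<Longrightarrow> cball (x i) (r i) \<subseteq> cball z t"
    "\<And>i. i \<in> S \<Longrightarrow> r i \<le> r0" "disjoint_family_on (\<lambda>i. cball (x i) (r i)) S"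
    "\<And>i. i \<in> S \<Longrightarrow> 0 < w i" "\<And>i. i \<in> S \<Longrightarrow> w i \<le> f (r i) / \<eta>" "sum w S = 1"
    "\<And>a \<rho>. 0 < \<rho> \<Longrightarrow> \<rho> \<le> \<rho>0 \<Longrightarrow>
      (\<exists>k. hits a \<rho> S \<subseteq> {k}) \<or> sum w (hits a \<rho> S) \<le> 2 * mass_const * (f \<rho> / \<eta>)"
  using assms by (simp_all only: mass_level_def)

text \<open>Since \<open>f / g\<close> is unbounded near \<open>0\<close>, the term \<open>g \<rho> / g t\<close> is dominated by \<open>f \<rho> / \<eta>\<close> for
  all \<open>\<rho>\<close> below a bound \<open>\<rho>0\<close> that depends on \<open>\<eta>\<close> and \<open>t\<close>.\<close>

lemma mass_level_start:
  assumes t: "0 < t" "t \<le> r0" and \<eta>: "0 < \<eta>"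
  obtains \<rho>0 S w where "0 < \<rho>0" "8 * \<rho>0 \<le> r0" "mass_level z t \<eta> \<rho>0 0 S w"
proof -
  have gt: "0 < g t" by (rule g_pos [OF t(1)])
  obtain t0 where t0: "t0 > 0" "\<And>\<rho>. 0 < \<rho> \<Longrightarrow> \<rho> \<le> t0 \<Longrightarrow> \<eta> / g t * g \<rho> \<le> f \<rho>"
    using steep [of "\<eta> / g t"] by blast
  define \<rho>0 where "\<rho>0 = min t0 (r0 / 8)"
  have \<rho>0: "0 < \<rho>0" "8 * \<rho>0 \<le> r0" "\<rho>0 \<le> t0" using t0(1) r0 by (auto simp: \<rho>0_def)
  obtain N where N: "N \<ge> (0::nat)" "\<And>i. i \<ge> N \<Longrightarrow> r i < r0" by (rule r_less_from [OF r0, of 0]) blast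
  obtain S w where "mass_family 1 \<eta> N z t S w"
    by (rule mass_family_exists [OF t zero_less_one \<eta>])
  note S = mass_familyD [OF this]
  have "mass_level z t \<eta> \<rho>0 0 S w"
    unfolding mass_level_def
  proof (intro conjI ballI allI impI)
    show "cball (x i) (r i) \<subseteq> cball z t" if "i \<in> S" for i using S(3) [OF that] ball_subset_cball by blast
    show "r i \<le> r0" if "i \<in> S" for i using S(2) N(2) [of i] that by auto
    fix a \<rho> assume \<rho>: "0 < \<rho>" "\<rho> \<le> \<rho>0"
    have "g \<rho> / g t \<le> f \<rho> / \<eta>" using t0(2) [of \<rho>] \<rho> \<rho>0 gt \<eta> by (simp add: field_simps)
    then have "mass_const * (1 * g \<rho> / g t + f \<rho> / \<eta>) \<le> mass_const * (2 * (f \<rho> / \<eta>))"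
      using mass_const_ge_1 by (intro mult_left_mono) auto
    then show "(\<exists>k. hits a \<rho> S \<subseteq> {k}) \<or> sum w (hits a \<rho> S) \<le> 2 * mass_const * (f \<rho> / \<eta>)"
      using S(8) [of \<rho> a] \<rho> \<rho>0(2) by fastforce
  qed (use S in auto)
  then show thesis using \<rho>0 by (intro that)
qed

text \<open>The mass of every ball is distributed inside it. The constants do not accumulate over the
  levels: a ball that meets two balls of the old level is estimated there, since the mass below a ball does not
  change, and a ball that meets only one ball of the old level is estimated inside that ball, where \<open>f / g\<close>
  nonincreasing and \<open>w i \<le> f (r i) / \<eta>\<close> absorb the first term of the estimate.\<close>

lemma mass_level_refine:
  assumes \<eta>: "0 < \<eta>" and \<rho>0: "8 * \<rho>0 \<le> r0" and level: "mass_level z t \<eta> \<rho>0 n S w"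
  obtains S' w' where "mass_level z t \<eta> \<rho>0 (Suc n) S' w'"
    "\<And>j. j \<in> S' \<Longrightarrow> \<exists>i\<in>S. cball (x j) (r j) \<subseteq> cball (x i) (r i)"
proof -
  note S = mass_levelD [OF level]
  obtain N where N: "N \<ge> Suc n" "\<And>i. i \<ge> N \<Longrightarrow> r i < r0" by (rule r_less_from [OF r0, of "Suc n"]) blast
  have "\<forall>i\<in>S. \<exists>p. mass_family (w i) \<eta> N (x i) (r i) (fst p) (snd p)"
  proof
    fix i assume i: "i \<in> S"
    obtain T v where "mass_family (w i) \<eta> N (x i) (r i) T v"
      by (rule mass_family_exists [OF r_pos S(4,6) [OF i] \<eta>])
    then show "\<exists>p. mass_family (w i) \<eta> N (x i) (r i) (fst p) (snd p)"
      by (intro exI [of _ "(T, v)"]) simp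
  qed
  from bchoice [OF this] obtain p
    where "\<And>i. i \<in> S \<Longrightarrow> mass_family (w i) \<eta> N (x i) (r i) (fst (p i)) (snd (p i))" by blast
  then obtain T v where fam: "\<And>i. i \<in> S \<Longrightarrow> mass_family (w i) \<eta> N (x i) (r i) (T i) (v i)"
    by (intro that [of "\<lambda>i. fst (p i)" "\<lambda>i. snd (p i)"])
  note T = mass_familyD [OF fam]
  have sub: "cball (x j) (r j) \<subseteq> cball (x i) (r i)" if "i \<in> S" "j \<in> T i" for i j
    using T(3) [OF that] ball_subset_cball by blast
  have dis: "cball (x j) (r j) \<inter> cball (x k) (r k) = {}"
    if "i \<in> S" "l \<in> S" "i \<noteq> l" "j \<in> T i" "k \<in> T l" for i l j k
    using S(5) sub [OF that(1,4)] sub [OF that(2,5)] that(1-3) unfolding disjoint_family_on_def by blast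
  have ne: "x i \<in> cball (x i) (r i)" for i using r_pos [of i] by simp
  have unique: "i = l" if "i \<in> S" "l \<in> S" "j \<in> T i" "j \<in> T l" for i l j
    using dis [of i l j j] that ne [of j] by blast
  define parent where "parent j = (THE i. i \<in> S \<and> j \<in> T i)" for j
  have parent: "parent j = i" if "i \<in> S" "j \<in> T i" for i j
    unfolding parent_def using that unique by blast
  define S' where "S' = (\<Union>i\<in>S. T i)"
  define w' where "w' j = v (parent j) j" for j
  have w': "w' j = v i j" if "i \<in> S" "j \<in> T i" for i j using parent [OF that] by (simp add: w'_def)
  have sum_child: "sum w' (T i) = w i" if "i \<in> S" for i
    using T(7) [OF that] w' [OF that] by (simp cong: sum.cong)
  have sum_children: "sum w' (\<Union>i\<in>A. T i) = sum w A" if "A \<subseteq> S" for A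
  proof -
    have "sum w' (\<Union>i\<in>A. T i) = (\<Sum>i\<in>A. sum w' (T i))"
    proof (rule sum.UNION_disjoint)
      show "finite A" using that S(1) by (rule finite_subset)
      show "\<forall>i\<in>A. finite (T i)" using that T(1) by blast
      show "\<forall>i\<in>A. \<forall>l\<in>A. i \<noteq> l \<longrightarrow> T i \<inter> T l = {}" using that unique by blast
    qed
    also have "\<dots> = sum w A" using sum_child that by (intro sum.cong) auto
    finally show ?thesis .
  qed
  have S'_E: "\<exists>i\<in>S. j \<in> T i" if "j \<in> S'" for j using that by (auto simp: S'_def)
  have w'_pos: "0 < w' j" if "j \<in> S'" for j
    using S'_E [OF that] T(5) w' by metis
  have fin: "finite S'" unfolding S'_def using S(1) T(1) by blast
  have "mass_level z t \<eta> \<rho>0 (Suc n) S' w'"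
    unfolding mass_level_def
  proof (intro conjI ballI allI impI)
    show "finite S'" by (rule fin)
    show "S' \<subseteq> {Suc n..}"
    proof
      fix j assume "j \<in> S'"
      then obtain i where "i \<in> S" "j \<in> T i" using S'_E by blast
      then show "j \<in> {Suc n..}" using T(2) [of i] N(1) by auto
    qed
    show "disjoint_family_on (\<lambda>i. cball (x i) (r i)) S'"
      unfolding disjoint_family_on_def
    proof (intro ballI impI)
      fix j k assume jk: "j \<in> S'" "k \<in> S'" "j \<noteq> k"
      then obtain i l where il: "i \<in> S" "j \<in> T i" "l \<in> S" "k \<in> T l" using S'_E by metis
      show "cball (x j) (r j) \<inter> cball (x k) (r k) = {}"
      proof (cases "i = l")
        case True
        then show ?thesis using T(4) [OF il(1)] il jk(3) unfolding disjoint_family_on_def by blast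
      next
        case False
        then show ?thesis using dis il by blast
      qed
    qed
    show "sum w' S' = 1" using sum_children [OF subset_refl] S(8) by (simp add: S'_def)
    fix j assume "j \<in> S'"
    then obtain i where i: "i \<in> S" "j \<in> T i" using S'_E by blast
    show "cball (x j) (r j) \<subseteq> cball z t" using sub [OF i] S(3) [OF i(1)] by blast
    show "r j \<le> r0" using T(2) [OF i(1)] i(2) N(2) [of j] by auto
    show "0 < w' j" using w' [OF i] T(5) [OF i] by simp
    show "w' j \<le> f (r j) / \<eta>" using w' [OF i] T(6) [OF i] by simp
  next
    fix a \<rho> assume \<rho>: "0 < \<rho>" "\<rho> \<le> \<rho>0"
    have pos: "0 < g \<rho>" "0 < f \<rho> / \<eta>" using g_pos f_pos \<rho>(1) \<eta> by auto
    have "hits a \<rho> S' \<subseteq> (\<Union>i\<in>hits a \<rho> S. T i)"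
    proof
      fix j assume j: "j \<in> hits a \<rho> S'"
      then obtain i where i: "i \<in> S" "j \<in> T i" using S'_E hits_subset by blast
      then have "i \<in> hits a \<rho> S" using sub [OF i] j unfolding hits_def by blast
      then show "j \<in> (\<Union>i\<in>hits a \<rho> S. T i)" using i(2) by blast
    qed
    moreover have "hits a \<rho> S \<subseteq> S" by (rule hits_subset)
    moreover have "finite (\<Union>i\<in>hits a \<rho> S. T i)"
      using fin by (rule finite_subset [rotated]) (use hits_subset in \<open>force simp: S'_def\<close>)
    moreover have "0 \<le> w' j" if "j \<in> (\<Union>i\<in>hits a \<rho> S. T i)" for j
      using that w'_pos [of j] hits_subset [of a \<rho> S] by (force simp: S'_def)
    ultimately have le_parents: "sum w' (hits a \<rho> S') \<le> sum w (hits a \<rho> S)"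
      using sum_children [of "hits a \<rho> S"] sum_mono2 [of "\<Union>i\<in>hits a \<rho> S. T i" "hits a \<rho> S'" w'] by auto
    show "(\<exists>k. hits a \<rho> S' \<subseteq> {k}) \<or> sum w' (hits a \<rho> S') \<le> 2 * mass_const * (f \<rho> / \<eta>)"
    proof (cases "\<exists>k. hits a \<rho> S \<subseteq> {k}")
      case False
      then show ?thesis using S(9) [OF \<rho>, of a] le_parents by (blast intro: order_trans)
    next
      case True
      then consider "hits a \<rho> S = {}" | i where "hits a \<rho> S = {i}" by blast
      then show ?thesis
      proof cases
        case 1
        then show ?thesis using \<open>hits a \<rho> S' \<subseteq> (\<Union>i\<in>hits a \<rho> S. T i)\<close> by auto
      next
        case 2
        then have i: "i \<in> S" using hits_subset [of a \<rho> S] by auto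
        show ?thesis
        proof (cases "\<rho> \<le> r i")
          case True
          have eq: "hits a \<rho> S' = hits a \<rho> (T i)"
            using \<open>hits a \<rho> S' \<subseteq> (\<Union>i\<in>hits a \<rho> S. T i)\<close> i unfolding 2 by (auto simp: hits_def S'_def)
          have sum_eq: "sum w' (hits a \<rho> (T i)) = sum (v i) (hits a \<rho> (T i))"
            using w' [OF i] hits_subset [of a \<rho> "T i"] by (intro sum.cong) auto
          have gr: "0 < g (r i)" using g_pos r_pos by simp
          have "w i * g \<rho> / g (r i) \<le> f (r i) / \<eta> * g \<rho> / g (r i)"
            using S(7) [OF i] pos gr by (intro divide_right_mono mult_right_mono) auto
          also have "\<dots> \<le> f \<rho> / \<eta>"
            using ratio [OF \<rho>(1) True] gr \<eta> by (simp add: field_simps)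
          finally have "mass_const * (w i * g \<rho> / g (r i) + f \<rho> / \<eta>) \<le> mass_const * (2 * (f \<rho> / \<eta>))"
            using mass_const_ge_1 by (intro mult_left_mono) auto
          then show ?thesis
            using T(8) [OF i \<rho>(1), of a] \<rho>(2) \<rho>0 unfolding eq sum_eq by fastforce
        next
          case False
          have "sum w' (hits a \<rho> S') \<le> w i" using le_parents 2 by simp
          also have "\<dots> \<le> f (r i) / \<eta>" by (rule S(7) [OF i])
          also have "\<dots> \<le> f \<rho> / \<eta>"
            using f_mono [of "r i" \<rho>] r_pos False \<eta> by (intro divide_right_mono) auto
          also have "\<dots> \<le> 2 * mass_const * (f \<rho> / \<eta>)"
            using mass_const_ge_1 pos(2) mult_right_mono [of 1 "2 * mass_const" "f \<rho> / \<eta>"] by simp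
          finally show ?thesis by blast
        qed
      qed
    qed
  qed
  moreover have "\<exists>i\<in>S. cball (x j) (r j) \<subseteq> cball (x i) (r i)" if "j \<in> S'" for j
    using S'_E [OF that] sub by blast
  ultimately show thesis by (rule that)
qed

lemma mass_level_sequence:
  assumes t: "0 < t" "t \<le> r0" and \<eta>: "0 < \<eta>"
  obtains \<rho>0 S w where "0 < \<rho>0" "\<And>n. mass_level z t \<eta> \<rho>0 n (S n) (w n)"
    "\<And>n. (\<Union>i\<in>S (Suc n). cball (x i) (r i)) \<subseteq> (\<Union>i\<in>S n. cball (x i) (r i))"
proof -
  obtain \<rho>0 S0 w0 where \<rho>0: "0 < \<rho>0" "8 * \<rho>0 \<le> r0" "mass_level z t \<eta> \<rho>0 0 S0 w0"
    by (rule mass_level_start [OF t \<eta>])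
  have "\<exists>p. \<forall>n. mass_level z t \<eta> \<rho>0 n (fst (p n)) (snd (p n)) \<and>
      (\<forall>j\<in>fst (p (Suc n)). \<exists>i\<in>fst (p n). cball (x j) (r j) \<subseteq> cball (x i) (r i))"
  proof (rule dependent_nat_choice)
    show "\<exists>p. mass_level z t \<eta> \<rho>0 0 (fst p) (snd p)"
      using \<rho>0(3) by (intro exI [of _ "(S0, w0)"]) simp
    fix p n assume "mass_level z t \<eta> \<rho>0 n (fst p) (snd p)"
    then obtain S' w' where "mass_level z t \<eta> \<rho>0 (Suc n) S' w'"
      "\<And>j. j \<in> S' \<Longrightarrow> \<exists>i\<in>fst p. cball (x j) (r j) \<subseteq> cball (x i) (r i)"
      by (rule mass_level_refine [OF \<eta> \<rho>0(2)]) blast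
    then show "\<exists>q. mass_level z t \<eta> \<rho>0 (Suc n) (fst q) (snd q) \<and>
        (\<forall>j\<in>fst q. \<exists>i\<in>fst p. cball (x j) (r j) \<subseteq> cball (x i) (r i))"
      by (intro exI [of _ "(S', w')"]) simp
  qed
  then obtain p where p: "\<And>n. mass_level z t \<eta> \<rho>0 n (fst (p n)) (snd (p n))"
    "\<And>n. \<forall>j\<in>fst (p (Suc n)). \<exists>i\<in>fst (p n). cball (x j) (r j) \<subseteq> cball (x i) (r i)" by blast
  show thesis
  proof (rule that [of \<rho>0 "\<lambda>n. fst (p n)" "\<lambda>n. snd (p n)"])
    show "(\<Union>i\<in>fst (p (Suc n)). cball (x i) (r i)) \<subseteq> (\<Union>i\<in>fst (p n). cball (x i) (r i))" for n
      using p(2) [of n] by blast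
  qed (use p(1) \<rho>0(1) in auto)
qed

lemma f_enlarge:
  assumes "0 < \<rho>"
  obtains \<rho>' where "\<rho> < \<rho>'" "\<rho>' \<le> 2 * \<rho>" "f \<rho>' \<le> 2 * f \<rho>"
proof -
  have "continuous (at \<rho>) f" using f_cont assms by (simp add: continuous_on_eq_continuous_at)
  then have "(f \<longlongrightarrow> f \<rho>) (at_right \<rho>)"
    unfolding isCont_def by (rule filterlim_at_split [THEN iffD1, THEN conjunct2])
  then have "\<forall>\<^sub>F u in at_right \<rho>. f u < 2 * f \<rho>"
    using f_pos [OF assms] by (intro order_tendstoD(2)) auto
  moreover have "\<forall>\<^sub>F u in at_right \<rho>. u < 2 * \<rho>"
    unfolding eventually_at_right_field using assms by (intro exI [of _ "2 * \<rho>"]) auto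
  moreover have "\<forall>\<^sub>F u in at_right \<rho>. \<rho> < u" by (rule eventually_at_right_less)
  ultimately have "\<forall>\<^sub>F u in at_right \<rho>. \<rho> < u \<and> u < 2 * \<rho> \<and> f u < 2 * f \<rho>"
    by eventually_elim auto
  then obtain u where "\<rho> < u \<and> u < 2 * \<rho> \<and> f u < 2 * f \<rho>"
    using eventually_happens trivial_limit_at_right_real by blast
  then show thesis by (intro that [of u]) auto
qed

text \<open>Given a cover of the limsup set by small closed balls, open balls of slightly larger radius
  cover the compact intersection \<open>K\<close> of the levels, hence finitely many of them cover some level and all
  later ones. The levels beyond have radii below those of the finitely many covering balls, so that
  the mass met by each of these is bounded by its \<open>f\<close>-value even if it meets one
  ball only.\<close>

lemma measure_limsup_ge:
  assumes t: "0 < t" "t \<le> r0" and comp: "compact (cball z t)" and \<eta>: "0 < \<eta>"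
  shows "ennreal (\<eta> / (4 * mass_const)) \<le> hausdorff_measure f (cball z t \<inter> limsup (\<lambda>i. cball (x i) (r i)))"
    (is "_ \<le> hausdorff_measure f ?F")
proof -
  obtain \<rho>0 S w where \<rho>0: "0 < \<rho>0" and lev: "\<And>n. mass_level z t \<eta> \<rho>0 n (S n) (w n)"
    and nest: "\<And>n. (\<Union>i\<in>S (Suc n). cball (x i) (r i)) \<subseteq> (\<Union>i\<in>S n. cball (x i) (r i))"
    by (rule mass_level_sequence [OF t \<eta>]) blast
  note S = mass_levelD [OF lev]
  define E where "E n = (\<Union>i\<in>S n. cball (x i) (r i))" for n
  have E_antimono: "E m \<subseteq> E n" if "n \<le> m" for n m
    using lift_Suc_antimono_le [of E] nest that unfolding E_def by blast
  have E_closed: "closed (E n)" for n unfolding E_def using S(1) by (intro closed_UN) auto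
  have E_sub: "E n \<subseteq> cball z t" for n unfolding E_def using S(3) by blast
  have E_compact: "compact (E n)" for n
    using compact_Int_closed [OF comp E_closed [of n]] E_sub [of n] by (simp add: Int_absorb1)
  define K where "K = (\<Inter>n. E n)"
  have K_compact: "compact K"
  proof -
    have "K = E 0 \<inter> K" unfolding K_def by blast
    moreover have "closed K" unfolding K_def using E_closed by (intro closed_INT) auto
    ultimately show ?thesis using compact_Int_closed [OF E_compact [of 0]] by metis
  qed
  have K_sub: "K \<subseteq> ?F"
  proof
    fix p assume "p \<in> K"
    then have pE: "p \<in> E n" for n by (auto simp: K_def)
    have "\<exists>i\<ge>n. p \<in> cball (x i) (r i)" for n
      using pE [of n] S(2) [of n] unfolding E_def by fastforce
    then have "p \<in> limsup (\<lambda>i. cball (x i) (r i))" unfolding limsup_INF_SUP by auto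
    then show "p \<in> ?F" using pE [of 0] E_sub by blast
  qed
  have "ennreal (\<eta> / (4 * mass_const)) \<le> hausdorff_premeasure f (\<rho>0 / 2) ?F"
    unfolding hausdorff_premeasure_def
  proof (rule INF_greatest)
    fix C assume C: "C \<in> ball_covers (\<rho>0 / 2) ?F"
    have Cr: "0 < snd c" "snd c \<le> \<rho>0 / 2" if "c \<in> C" for c
      using C that by (auto simp: ball_covers_def split_beta)
    have "\<forall>c\<in>C. \<exists>\<rho>'. snd c < \<rho>' \<and> \<rho>' \<le> \<rho>0 \<and> f \<rho>' \<le> 2 * f (snd c)"
    proof
      fix c assume c: "c \<in> C"
      obtain \<rho>' where "snd c < \<rho>'" "\<rho>' \<le> 2 * snd c" "f \<rho>' \<le> 2 * f (snd c)"
        by (rule f_enlarge [OF Cr(1) [OF c]])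
      then show "\<exists>\<rho>'. snd c < \<rho>' \<and> \<rho>' \<le> \<rho>0 \<and> f \<rho>' \<le> 2 * f (snd c)"
        using Cr(2) [OF c] by (intro exI [of _ \<rho>']) auto
    qed
    from bchoice [OF this] obtain R where
      R: "\<And>c. c \<in> C \<Longrightarrow> snd c < R c" "\<And>c. c \<in> C \<Longrightarrow> R c \<le> \<rho>0" "\<And>c. c \<in> C \<Longrightarrow> f (R c) \<le> 2 * f (snd c)"
      by blast
    have R_pos: "0 < R c" if "c \<in> C" for c using R(1) Cr(1) that by fastforce
    have "?F \<subseteq> (\<Union>c\<in>C. cball (fst c) (snd c))"
      using C by (simp add: ball_covers_def split_beta)
    also have "\<dots> \<subseteq> (\<Union>c\<in>C. ball (fst c) (R c))" using R(1) by fastforce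
    finally have "K \<subseteq> (\<Union>c\<in>C. ball (fst c) (R c))" using K_sub by blast
    then obtain C' where C': "C' \<subseteq> C" "finite C'" "K \<subseteq> (\<Union>c\<in>C'. ball (fst c) (R c))"
      using compactE_image [OF K_compact, of C "\<lambda>c. ball (fst c) (R c)"] by auto
    define W where "W = (\<Union>c\<in>C'. ball (fst c) (R c))"
    have "open W" unfolding W_def by auto
    have "\<exists>n. E n \<subseteq> W"
    proof (rule ccontr)
      assume none: "\<nexists>n. E n \<subseteq> W"
      have "E 0 \<inter> (\<Inter>n. E n - W) \<noteq> {}"
      proof (rule compact_imp_fip_image [OF E_compact])
        show "closed (E n - W)" for n using E_closed \<open>open W\<close> by (rule closed_Diff)
        fix I :: "nat set" assume I: "finite I"
        define m where "m = Max (insert 0 I)"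
        have "\<And>n. n \<in> insert 0 I \<Longrightarrow> n \<le> m" unfolding m_def using I by (intro Max_ge) auto
        then have "E m - W \<subseteq> E 0 \<inter> (\<Inter>n\<in>I. E n - W)" using E_antimono by blast
        then show "E 0 \<inter> (\<Inter>n\<in>I. E n - W) \<noteq> {}" using none by blast
      qed
      then show False using C'(3) unfolding K_def W_def by blast
    qed
    then obtain n where n: "E n \<subseteq> W" by blast
    define e where "e = Min (insert 1 (R ` C'))"
    have e: "0 < e" unfolding e_def using C' R_pos by auto
    have e_le: "e \<le> R c" if "c \<in> C'" for c unfolding e_def by (rule Min_le) (use C'(2) that in auto)
    obtain N where N: "N \<ge> n" "\<And>i. i \<ge> N \<Longrightarrow> r i < e" by (rule r_less_from [OF e, of n]) blast
    have hit: "\<exists>c\<in>C'. i \<in> hits (fst c) (R c) (S N)" if i: "i \<in> S N" for i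
    proof -
      have "x i \<in> cball (x i) (r i)" using r_pos [of i] by simp
      then have "x i \<in> E N" using i unfolding E_def by blast
      then have "x i \<in> W" using n E_antimono [OF N(1)] by blast
      then obtain c where "c \<in> C'" "x i \<in> cball (fst c) (R c)" by (auto simp: W_def)
      then show ?thesis using i \<open>x i \<in> cball (x i) (r i)\<close> unfolding hits_def by blast
    qed
    have "1 = sum (w N) (S N)" by (rule S(8) [symmetric])
    also have "\<dots> \<le> (\<Sum>i\<in>S N. \<Sum>c\<in>C'. if i \<in> hits (fst c) (R c) (S N) then w N i else 0)"
    proof (rule sum_mono)
      fix i assume i: "i \<in> S N"
      then obtain c where c: "c \<in> C'" "i \<in> hits (fst c) (R c) (S N)" using hit by blast
      have "w N i = (\<Sum>c\<in>{c}. if i \<in> hits (fst c) (R c) (S N) then w N i else 0)" using c by simp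
      also have "\<dots> \<le> (\<Sum>c\<in>C'. if i \<in> hits (fst c) (R c) (S N) then w N i else 0)"
        using c(1) C'(2) S(6) [OF i] by (intro sum_mono2) (auto simp: less_imp_le)
      finally show "w N i \<le> \<dots>" .
    qed
    also have "\<dots> = (\<Sum>c\<in>C'. \<Sum>i\<in>S N. if i \<in> hits (fst c) (R c) (S N) then w N i else 0)"
      by (rule sum.swap)
    also have "\<dots> = (\<Sum>c\<in>C'. sum (w N) (hits (fst c) (R c) (S N)))"
      using S(1) hits_subset by (intro sum.cong [OF refl]) (simp add: sum.If_cases Int_absorb1)
    also have "\<dots> \<le> (\<Sum>c\<in>C'. 4 * mass_const / \<eta> * f (snd c))"
    proof (rule sum_mono)
      fix c assume c: "c \<in> C'"
      then have cC: "c \<in> C" using C'(1) by blast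
      have pos: "0 < f (R c) / \<eta>" using f_pos [OF R_pos [OF cC]] \<eta> by simp
      have "sum (w N) (hits (fst c) (R c) (S N)) \<le> 2 * mass_const * (f (R c) / \<eta>)"
      proof (cases "\<exists>k. hits (fst c) (R c) (S N) \<subseteq> {k}")
        case False
        then show ?thesis using S(9) [OF R_pos [OF cC] R(2) [OF cC]] by blast
      next
        case True
        then consider "hits (fst c) (R c) (S N) = {}" | i where "hits (fst c) (R c) (S N) = {i}" by blast
        then show ?thesis
        proof cases
          case 1
          have "0 \<le> 2 * mass_const * (f (R c) / \<eta>)" using pos mass_const_ge_1 by (intro mult_nonneg_nonneg) auto
          then show ?thesis using 1 by simp
        next
          case 2
          then have i: "i \<in> S N" using hits_subset by blast
          have "r i < e" using i S(2) [of N] N(2) [of i] by auto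
          then have "r i \<le> R c" using e_le [OF c] by linarith
          have "w N i \<le> f (r i) / \<eta>" by (rule S(7) [OF i])
          also have "\<dots> \<le> f (R c) / \<eta>"
            using f_mono [OF r_pos \<open>r i \<le> R c\<close>] \<eta> by (intro divide_right_mono) auto
          also have "\<dots> \<le> 2 * mass_const * (f (R c) / \<eta>)"
            using mass_const_ge_1 pos mult_right_mono [of 1 "2 * mass_const" "f (R c) / \<eta>"] by simp
          finally show ?thesis using 2 by simp
        qed
      qed
      also have "\<dots> \<le> 2 * mass_const * (2 * f (snd c) / \<eta>)"
        using R(3) [OF cC] mass_const_ge_1 \<eta> by (intro mult_left_mono divide_right_mono) auto
      finally show "sum (w N) (hits (fst c) (R c) (S N)) \<le> 4 * mass_const / \<eta> * f (snd c)" by simp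
    qed
    also have "\<dots> = 4 * mass_const / \<eta> * (\<Sum>c\<in>C'. f (snd c))" by (simp add: sum_distrib_left)
    finally have "\<eta> / (4 * mass_const) \<le> (\<Sum>c\<in>C'. f (snd c))"
      using \<eta> mass_const_ge_1 by (simp add: field_simps)
    then have "ennreal (\<eta> / (4 * mass_const)) \<le> ennreal (\<Sum>c\<in>C'. f (snd c))" by (rule ennreal_leI)
    also have "\<dots> = (\<Sum>c\<in>C'. ennreal (f (snd c)))"
    proof (rule sum_ennreal [symmetric])
      show "0 \<le> f (snd c)" if "c \<in> C'" for c
        using f_pos [OF Cr(1), of c] C'(1) that by (auto simp: less_imp_le)
    qed
    also have "\<dots> = (\<Sum>(x, r)\<in>C'. ennreal (f r))" by (simp add: split_beta)
    also have "\<dots> \<le> infsum (\<lambda>(x, r). ennreal (f r)) C"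
      using C' by (intro sum_le_infsum_ennreal)
    finally show "ennreal (\<eta> / (4 * mass_const)) \<le> infsum (\<lambda>(x, r). ennreal (f r)) C" .
  qed
  also have "\<dots> \<le> hausdorff_measure f ?F"
    using \<rho>0 by (intro hausdorff_premeasure_le_measure) auto
  finally show ?thesis .
qed

lemma measure_limsup_infinite:
  assumes t: "0 < t" "t \<le> r0" and comp: "compact (cball z t)"
  shows "hausdorff_measure f (cball z t \<inter> limsup (\<lambda>i. cball (x i) (r i))) = top"
proof (rule ccontr)
  assume "\<not> ?thesis"
  then obtain b where b: "0 \<le> b" "hausdorff_measure f (cball z t \<inter> limsup (\<lambda>i. cball (x i) (r i))) = ennreal b"
    by (cases "hausdorff_measure f (cball z t \<inter> limsup (\<lambda>i. cball (x i) (r i)))") auto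
  have "ennreal (4 * mass_const * (b + 1) / (4 * mass_const)) \<le> ennreal b"
    unfolding b(2) [symmetric] using mass_const_ge_1 b(1) by (intro measure_limsup_ge t comp) simp
  then show False using b(1) mass_const_ge_1 by (simp add: ennreal_le_iff)
qed

end

section \<open>Topological preliminaries and the mass transference principle\<close>

lemma locally_compact_cball:
  fixes z :: "'a::metric_space"
  assumes "locally_compact_space (euclidean :: 'a::metric_space topology)"
  obtains e where "e > 0" "\<And>t. t \<le> e \<Longrightarrow> compact (cball z t)"
proof -
  obtain U K where UK: "open U" "compact K" "z \<in> U" "U \<subseteq> K"
    using assms unfolding locally_compact_space_def by (metis UNIV_I compactin_euclidean_iff open_openin topspace_euclidean)
  then obtain e where e: "e > 0" "cball z e \<subseteq> K" by (meson open_contains_cball order_trans)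
  have "compact (cball z t)" if "t \<le> e" for t
  proof -
    have "K \<inter> cball z t = cball z t" using e(2) subset_cball [OF that, of z] by blast
    then show ?thesis using compact_Int_closed [OF UK(2) closed_cball, of z t] by simp
  qed
  then show thesis using e(1) by (intro that)
qed

lemma countable_dense_of_small_ball_covers:
  assumes cover: "\<And>\<rho>. \<rho> > 0 \<Longrightarrow>
           \<exists>C :: ('a::metric_space \<times> real) set. countable C \<and>
             (\<forall>(y, s)\<in>C. s > 0 \<and> diameter (cball y s) < \<rho>) \<and> (\<Union>(y, s)\<in>C. cball y s) = UNIV"
  shows "\<exists>D :: 'a::metric_space set. countable D \<and> (\<forall>y e. 0 < e \<longrightarrow> (\<exists>d\<in>D. dist y d < e))"
proof -
  have "\<forall>n::nat. \<exists>C :: ('a \<times> real) set. countable C \<and>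
     (\<forall>(y, s)\<in>C. s > 0 \<and> diameter (cball y s) < 1 / real (Suc n)) \<and> (\<Union>(y, s)\<in>C. cball y s) = UNIV"
    using cover by simp
  from choice [OF this] obtain C :: "nat \<Rightarrow> ('a \<times> real) set" where C':
    "\<forall>n. countable (C n) \<and> (\<forall>(y, s)\<in>C n. s > 0 \<and> diameter (cball y s) < 1 / real (Suc n)) \<and>
      (\<Union>(y, s)\<in>C n. cball y s) = UNIV" ..
  then have C: "countable (C n)" "(\<Union>(y, s)\<in>C n. cball y s) = UNIV" for n by simp_all
  have C_small: "0 < s" "diameter (cball y s) < 1 / real (Suc n)" if "(y, s) \<in> C n" for y s n
    using C' that by blast+
  define D where "D = (\<Union>n. fst ` C n)"
  show ?thesis
  proof (intro exI [of _ D] conjI allI impI)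
    show "countable D" unfolding D_def using C(1) by auto
    fix y :: 'a and e :: real assume "0 < e"
    then obtain n where n: "1 / real (Suc n) < e" using nat_approx_posE by blast
    have "y \<in> (\<Union>(d, s)\<in>C n. cball d s)" using C(2) [of n] by simp
    then obtain d s where ds: "(d, s) \<in> C n" "y \<in> cball d s" by blast
    have "dist y d \<le> diameter (cball d s)"
      using ds C_small(1) [OF ds(1)] by (intro diameter_bounded_bound) auto
    also have "\<dots> < e" using C_small [OF ds(1)] n by auto
    finally show "\<exists>d\<in>D. dist y d < e" using ds(1) unfolding D_def by force
  qed
qed

theorem theorem3:
  fixes f g :: "real \<Rightarrow> real"
    and c1 c2 r0 :: real
    and x :: "nat \<Rightarrow> 'a::metric_space"
    and r :: "nat \<Rightarrow> real"
  assumes "locally_compact_space (euclidean :: 'a topology)"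
    and "\<And>\<rho>. \<rho> > 0 \<Longrightarrow>
           \<exists>C :: ('a \<times> real) set. countable C \<and>
             (\<forall>(y, s)\<in>C. s > 0 \<and> diameter (cball y s) < \<rho>) \<and>
             (\<Union>(y, s)\<in>C. cball y s) = UNIV"
    and "dimension_function g" and "doubling g"
    and "0 < c1" and "c1 < 1" and "1 < c2" and "r0 > 0"
    and "\<And>(y :: 'a) s. \<lbrakk>0 < s; s \<le> r0\<rbrakk> \<Longrightarrow>
           ennreal (c1 * g s) \<le> hausdorff_measure g (cball y s) \<and>
           hausdorff_measure g (cball y s) \<le> ennreal (c2 * g s)"
    and "\<And>i. r i > 0" and "r \<longlonglongrightarrow> 0"
    and "dimension_function f"
    and "mono_on {0<..} (\<lambda>t. f t / g t) \<or> antimono_on {0<..} (\<lambda>t. f t / g t)"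
    and "\<And>i. \<exists>!s. s > 0 \<and> g s = f (r i)"
    and "\<And>(y :: 'a) s. s > 0 \<Longrightarrow>
           hausdorff_measure g (cball y s \<inter> limsup (\<lambda>i. transformed_ball g f (x i) (r i))) =
           hausdorff_measure g (cball y s)"
  shows "\<forall>(y :: 'a) s. s > 0 \<longrightarrow>
           hausdorff_measure f (cball y s \<inter> limsup (\<lambda>i. cball (x i) (r i))) =
           hausdorff_measure f (cball y s)"
proof (intro allI impI)
  fix y :: 'a and \<sigma> :: real assume \<sigma>: "0 < \<sigma>"
  have f: "\<And>t. 0 < t \<Longrightarrow> 0 < f t" "continuous_on {0<..} f" "(f \<longlongrightarrow> 0) (at_right 0)"
    "\<And>t u. 0 < t \<Longrightarrow> t \<le> u \<Longrightarrow> f t \<le> f u"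
    using assms(12) by (auto simp: dimension_function_def mono_on_def)
  have g: "\<And>t. 0 < t \<Longrightarrow> 0 < g t" "\<And>t u. 0 < t \<Longrightarrow> t \<le> u \<Longrightarrow> g t \<le> g u"
    using assms(3) by (auto simp: dimension_function_def mono_on_def)
  obtain lam where lam: "1 < lam" "\<And>t. 0 < t \<Longrightarrow> g (2 * t) \<le> lam * g t"
    using assms(4) by (auto simp: doubling_def)
  obtain D :: "'a set" where D: "countable D" "\<And>y e. 0 < e \<Longrightarrow> \<exists>d\<in>D. dist y d < e"
    using countable_dense_of_small_ball_covers [OF assms(2)] by blast
  define s where "s i = the_inv_into {0<..} g (f (r i))" for i
  have s: "0 < s i" "g (s i) = f (r i)" for i
    using theI' [OF assms(14) [of i]] unfolding s_def the_inv_into_def by auto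
  have tball: "transformed_ball g f (x i) (r i) = cball (x i) (s i)" for i
    by (simp add: transformed_ball_def s_def)
  have "s \<longlonglongrightarrow> 0"
  proof (rule order_tendstoI)
    show "\<forall>\<^sub>F i in sequentially. a < s i" if "a < 0" for a
      using s(1) that by (intro always_eventually) (meson less_trans)
    fix a :: real assume a: "0 < a"
    have "filterlim r (at_right 0) sequentially"
      using assms(10,11) by (intro tendsto_imp_filterlim_at_right) auto
    then have "(\<lambda>i. f (r i)) \<longlonglongrightarrow> 0" by (rule filterlim_compose [OF f(3)])
    then have "\<forall>\<^sub>F i in sequentially. f (r i) < g a" using g(1) [OF a] by (intro order_tendstoD(2))
    then show "\<forall>\<^sub>F i in sequentially. s i < a"
    proof (rule eventually_mono)
      fix i assume "f (r i) < g a"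
      then have "\<not> g a \<le> g (s i)" by (simp add: s(2))
      then show "s i < a" using g(2) [OF a, of "s i"] by linarith
    qed
  qed
  interpret full_limsup g lam c1 c2 r0 D x s
    by unfold_locales
      (use g lam assms(5-9,15) D s(1) \<open>s \<longlonglongrightarrow> 0\<close> in \<open>auto simp: tball\<close>)
  show "hausdorff_measure f (cball y \<sigma> \<inter> limsup (\<lambda>i. cball (x i) (r i))) =
           hausdorff_measure f (cball y \<sigma>)" (is "hausdorff_measure f (_ \<inter> ?\<Lambda>) = _")
  proof (cases "\<exists>M \<delta>. 0 < \<delta> \<and> (\<forall>t. 0 < t \<longrightarrow> t \<le> \<delta> \<longrightarrow> f t \<le> M * g t)")
    case True
    then obtain M0 \<delta> where M0: "0 < \<delta>" "\<And>t. 0 < t \<Longrightarrow> t \<le> \<delta> \<Longrightarrow> f t \<le> M0 * g t" by blast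
    define M where "M = max 1 M0"
    have M: "1 \<le> M" "f t \<le> M * g t" if "0 < t" "t \<le> \<delta>" for t
    proof -
      have "M0 * g t \<le> M * g t" using g(1) [OF that(1)] by (intro mult_right_mono) (auto simp: M_def)
      then show "1 \<le> M" "f t \<le> M * g t" using M0(2) [OF that] by (auto simp: M_def)
    qed
    have M1: "1 \<le> M" by (simp add: M_def)
    \<comment> \<open>\<open>g (s i) = f (r i)\<close> makes the two radii comparable once \<open>r i < \<delta>\<close>\<close>
    obtain N where N: "\<And>i. N \<le> i \<Longrightarrow> r i < \<delta>"
      using order_tendstoD(2) [OF assms(11) M0(1)] unfolding eventually_sequentially by blast
    have "\<mu> (UNIV - ?\<Lambda>) = 0"
      using M(2) N s(2) assms(10) by (intro null_outside_comparable_limsup [OF _ M1, of r N]) (auto simp: less_imp_le)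
    then have null: "hausdorff_measure f (UNIV - ?\<Lambda>) = 0"
      by (rule hausdorff_measure_null_transfer [OF M0(1) _ M(2), rotated -1]) (use M1 in auto)
    have "hausdorff_measure f (cball y \<sigma>) \<le> hausdorff_measure f ((cball y \<sigma> \<inter> ?\<Lambda>) \<union> (UNIV - ?\<Lambda>))"
      by (rule hausdorff_measure_mono) blast
    also have "\<dots> \<le> hausdorff_measure f (cball y \<sigma> \<inter> ?\<Lambda>) + 0"
      using hausdorff_measure_Un_le [of f "cball y \<sigma> \<inter> ?\<Lambda>" "UNIV - ?\<Lambda>"] unfolding null .
    finally show ?thesis
      using hausdorff_measure_mono [of "cball y \<sigma> \<inter> ?\<Lambda>" "cball y \<sigma>" f] by (simp add: antisym)
  next
    case False
    \<comment> \<open>a nondecreasing quotient is bounded by its value at \<open>1\<close>, contrary to the case assumption\<close>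
    have "\<not> mono_on {0<..} (\<lambda>t. f t / g t)"
    proof
      assume mono: "mono_on {0<..} (\<lambda>t. f t / g t)"
      have "f t \<le> f 1 / g 1 * g t" if "0 < t" "t \<le> 1" for t
      proof -
        have "f t / g t \<le> f 1 / g 1" using that by (intro mono_onD [OF mono]) auto
        then show ?thesis using g(1) [OF that(1)] by (simp add: field_simps)
      qed
      then show False using False by (metis zero_less_one)
    qed
    then have anti: "antimono_on {0<..} (\<lambda>t. f t / g t)" using assms(13) by blast
    have ratio: "f u * g t \<le> f t * g u" if "0 < t" "t \<le> u" for t u
    proof -
      have "f u / g u \<le> f t / g t" using that by (intro monotone_onD [OF anti]) auto
      then show ?thesis using g(1) [of t] g(1) [of u] that by (simp add: field_simps)
    qed
    have steep: "\<exists>t0>0. \<forall>t. 0 < t \<longrightarrow> t \<le> t0 \<longrightarrow> M * g t \<le> f t" for M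
    proof -
      obtain t0 where t0: "0 < t0" "M * g t0 < f t0"
        using False by (metis not_le zero_less_one)
      have "M * g t \<le> f t" if t: "0 < t" "t \<le> t0" for t
      proof -
        have "M * g t0 * g t \<le> f t0 * g t" using t0(2) g(1) [OF t(1)] by simp
        also have "\<dots> \<le> f t * g t0" by (rule ratio [OF t])
        finally show ?thesis using g(1) [OF t0(1)] by (simp add: mult.assoc mult.left_commute)
      qed
      then show ?thesis using t0(1) by blast
    qed
    interpret steep_transference g lam c1 c2 r0 D x s f r
      by unfold_locales (use f s(2) assms(10,11) ratio steep in auto)
    obtain e where e: "e > 0" "\<And>t. t \<le> e \<Longrightarrow> compact (cball y t)"
      by (rule locally_compact_cball [OF assms(1), of y]) blast
    define t where "t = min e (min \<sigma> r0)"
    have t: "0 < t" "t \<le> r0" "t \<le> e" "t \<le> \<sigma>" using e(1) \<sigma> assms(8) by (auto simp: t_def)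
    have "hausdorff_measure f (cball y t \<inter> ?\<Lambda>) = top"
      by (rule measure_limsup_infinite [OF t(1,2) e(2) [OF t(3)]])
    moreover have "cball y t \<inter> ?\<Lambda> \<subseteq> cball y \<sigma> \<inter> ?\<Lambda>" using subset_cball [OF t(4), of y] by blast
    moreover have "cball y \<sigma> \<inter> ?\<Lambda> \<subseteq> cball y \<sigma>" by blast
    ultimately show ?thesis by (metis hausdorff_measure_mono top_unique)
  qed
qed

end
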